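(* There is a polynomial-time algorithm which, given a unicyclic graph $G$, computes the transitivity $Tr(G)$; consequently (since $D(G)=Tr(G)$ for unicyclic graphs) the upper domatic number $D(G)$ of a unicyclic graph can be computed in polynomial time.
   Context: All graphs are finite and simple. A unicyclic graph is a connected graph containing exactly one cycle. For disjoint vertex sets $A,B$ of a graph $G$, $A$ dominates $B$ if every vertex of $B$ is adjacent to at least one vertex of $A$. A transitive $k$-partition of $G$ is a partition of $V(G)$ into $k$ nonempty parts $V_1,\dots,V_k$ such that $V_i$ dominates $V_j$ for all $1\le i<j\le k$; the transitivity $Tr(G)$ is the maximum $k$ for which such a partition exists. An upper domatic partition of size $k$ is a partition of $V(G)$ into $k$ nonempty parts $V_1,\dots,V_k$ such that for all $1\le i<j\le k$, $V_i$ dominates $V_j$ or $V_j$ dominates $V_i$ (or both); the upper domatic number $D(G)$ is the maximum such $k$. *)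

theory Defs
  imports
    Main
    "HOL-Library.Disjoint_Sets"
    "HOL-Computational_Algebra.Polynomial"
begin

section \<open>Finite simple graphs\<close>

type_synonym 'a graph = "'a set \<times> 'a set set"

abbreviation verts :: "'a graph \<Rightarrow> 'a set" where "verts G \<equiv> fst G"
abbreviation edges :: "'a graph \<Rightarrow> 'a set set" where "edges G \<equiv> snd G"

definition simple_graph :: "'a graph \<Rightarrow> bool" where
  "simple_graph G \<longleftrightarrow>
     finite (verts G) \<and> edges G \<subseteq> {{u, v} | u v. u \<in> verts G \<and> v \<in> verts G \<and> u \<noteq> v}"

definition adjacent :: "'a graph \<Rightarrow> 'a \<Rightarrow> 'a \<Rightarrow> bool" where
  "adjacent G u v \<longleftrightarrow> {u, v} \<in> edges G"

definition connected_graph :: "'a graph \<Rightarrow> bool" where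
  "connected_graph G \<longleftrightarrow>
     verts G \<noteq> {} \<and> (\<forall>u \<in> verts G. \<forall>v \<in> verts G. (adjacent G)\<^sup>*\<^sup>* u v)"

text \<open>A cycle is identified with its edge set, so that the rotations and the reversal of a
  closed vertex sequence count as the same cycle.\<close>

definition is_cycle :: "'a graph \<Rightarrow> 'a set set \<Rightarrow> bool" where
  "is_cycle G C \<longleftrightarrow> C \<subseteq> edges G \<and>
     (\<exists>xs. distinct xs \<and> 3 \<le> length xs \<and>
           C = {{xs ! i, xs ! (Suc i mod length xs)} | i. i < length xs})"

definition unicyclic :: "'a graph \<Rightarrow> bool" where
  "unicyclic G \<longleftrightarrow> simple_graph G \<and> connected_graph G \<and> (\<exists>!C. is_cycle G C)"


section \<open>Transitivity and upper domatic number\<close>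

definition dominates :: "'a graph \<Rightarrow> 'a set \<Rightarrow> 'a set \<Rightarrow> bool" where
  "dominates G A B \<longleftrightarrow> (\<forall>b \<in> B. \<exists>a \<in> A. adjacent G b a)"

definition vertex_partition :: "'a graph \<Rightarrow> nat \<Rightarrow> (nat \<Rightarrow> 'a set) \<Rightarrow> bool" where
  "vertex_partition G k V \<longleftrightarrow>
     (\<forall>i \<in> {1..k}. V i \<noteq> {}) \<and> disjoint_family_on V {1..k} \<and> (\<Union>i \<in> {1..k}. V i) = verts G"

definition transitive_partition :: "'a graph \<Rightarrow> nat \<Rightarrow> (nat \<Rightarrow> 'a set) \<Rightarrow> bool" where
  "transitive_partition G k V \<longleftrightarrow> vertex_partition G k V \<and>
     (\<forall>i j. 1 \<le> i \<and> i < j \<and> j \<le> k \<longrightarrow> dominates G (V i) (V j))"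

definition upper_domatic_partition :: "'a graph \<Rightarrow> nat \<Rightarrow> (nat \<Rightarrow> 'a set) \<Rightarrow> bool" where
  "upper_domatic_partition G k V \<longleftrightarrow> vertex_partition G k V \<and>
     (\<forall>i j. 1 \<le> i \<and> i < j \<and> j \<le> k \<longrightarrow> dominates G (V i) (V j) \<or> dominates G (V j) (V i))"

definition transitivity :: "'a graph \<Rightarrow> nat" where
  "transitivity G = Max {k. \<exists>V. transitive_partition G k V}"

definition upper_domatic_number :: "'a graph \<Rightarrow> nat" where
  "upper_domatic_number G = Max {k. \<exists>V. upper_domatic_partition G k V}"


section \<open>Polynomial-time computability\<close>

text \<open>The machine model is a random access machine with structured control: a while language
  over natural numbers with multidimensional arrays.  The memory cell \<^term>\<open>(x, is)\<close> is the entry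
  of the array \<^term>\<open>x\<close> at the index tuple \<^term>\<open>is\<close>; scalars are arrays with the empty index.
  The only arithmetic operations are addition and truncated subtraction, so that after \<open>t\<close> steps
  every value has at most \<open>O(t + l)\<close> bits, where \<open>l\<close> bounds the bit lengths of the initial values
  (unit-cost multiplication would break this).  Expressions are part of the program text, hence of
  constant size, so charging one step for each assignment and each test yields the same
  polynomial-time functions as Turing machines.\<close>

type_synonym memory = "string \<times> nat list \<Rightarrow> nat"

datatype expr =
    Const nat
  | Cell string "expr list"
  | Plus expr expr
  | Minus expr expr

fun eval_expr :: "memory \<Rightarrow> expr \<Rightarrow> nat" where
  "eval_expr s (Const k) = k"
| "eval_expr s (Cell x es) = s (x, map (eval_expr s) es)"
| "eval_expr s (Plus a b) = eval_expr s a + eval_expr s b"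
| "eval_expr s (Minus a b) = eval_expr s a - eval_expr s b"

datatype prog =
    Skip
  | Assign string "expr list" expr
  | Seq prog prog
  | If expr prog prog
  | While expr prog

text \<open>\<^term>\<open>exec c s t s'\<close>: started in memory \<^term>\<open>s\<close>, the program \<^term>\<open>c\<close> halts after
  \<^term>\<open>t\<close> steps in memory \<^term>\<open>s'\<close>.  Tests succeed on nonzero values.\<close>

inductive exec :: "prog \<Rightarrow> memory \<Rightarrow> nat \<Rightarrow> memory \<Rightarrow> bool" where
  Skip: "exec Skip s 1 s"
| Assign: "exec (Assign x es e) s 1 (s((x, map (eval_expr s) es) := eval_expr s e))"
| Seq: "exec c1 s t1 s' \<Longrightarrow> exec c2 s' t2 s'' \<Longrightarrow> exec (Seq c1 c2) s (t1 + t2) s''"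
| IfTrue: "eval_expr s e \<noteq> 0 \<Longrightarrow> exec c1 s t s' \<Longrightarrow> exec (If e c1 c2) s (t + 1) s'"
| IfFalse: "eval_expr s e = 0 \<Longrightarrow> exec c2 s t s' \<Longrightarrow> exec (If e c1 c2) s (t + 1) s'"
| WhileFalse: "eval_expr s e = 0 \<Longrightarrow> exec (While e c) s 1 s"
| WhileTrue: "eval_expr s e \<noteq> 0 \<Longrightarrow> exec c s t1 s' \<Longrightarrow> exec (While e c) s' t2 s'' \<Longrightarrow>
    exec (While e c) s (t1 + t2 + 1) s''"

text \<open>A graph is presented by its number of vertices and its adjacency matrix with respect to an
  enumeration \<^term>\<open>vs\<close> of its vertices.  All other cells are initially zero.\<close>

definition graph_input :: "'a graph \<Rightarrow> 'a list \<Rightarrow> memory" where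
  "graph_input G vs = (\<lambda>(x, is).
     if x = ''n'' \<and> is = [] then length vs
     else if x = ''adj'' \<and>
       (\<exists>i j. is = [i, j] \<and> i < length vs \<and> j < length vs \<and> adjacent G (vs ! i) (vs ! j)) then 1
     else 0)"

text \<open>The running time is measured in the number of vertices, which is polynomially related to the
  size of the adjacency matrix.  Nothing is required of the program outside the class \<^term>\<open>P\<close>
  of admissible inputs.\<close>

definition poly_time_computable_on :: "('a graph \<Rightarrow> bool) \<Rightarrow> ('a graph \<Rightarrow> nat) \<Rightarrow> bool" where
  "poly_time_computable_on P f \<longleftrightarrow>
     (\<exists>(c :: prog) (q :: nat poly). \<forall>G vs. P G \<and> distinct vs \<and> set vs = verts G \<longrightarrow>
        (\<exists>t s'. exec c (graph_input G vs) t s' \<and> t \<le> poly q (length vs) \<and> s' (''out'', []) = f G))"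

end

theory Submission
  imports Defs
begin

text \<open>A transitive partition is the same as a labelling of the vertices by positive integers such
  that every vertex has a neighbour of each smaller label, so dependencies run from larger to
  smaller labels.  Let \<open>s\<close> be a vertex of minimal label \<open>a\<close> on the cycle.  It does not depend on its
  two neighbours on the cycle, so after deleting the two cycle edges at \<open>s\<close> and granting the label
  \<open>a\<close> to these two neighbours for free, the labelling lives on a forest.  There the largest label of
  a vertex is computed greedily from the largest labels of its subtrees, because the labels
  available at a neighbour are closed downwards.  Conversely, the component of \<open>s\<close> in the forest
  contains neither of its neighbours on the cycle, so a labelling in which they use the free label
  and one that gives \<open>s\<close> the label \<open>a\<close> do not interfere.  Trying all \<open>s\<close> and \<open>a\<close> gives the algorithm.

  For the upper domatic number, orient each pair of classes by domination.  Three classes that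
  dominate each other cyclically contain the cycle, hence there is at most one such triple, and
  every other class dominates it.  Such a triple can be turned into three transitive classes.\<close>

section \<open>Cycle edges\<close>

text \<open>On a tree one would fix a root and work towards it. Here the vertex that is to carry the
  large label is arbitrary, and \<open>s\<close> must be given its label as well, so the greedy
  values are attached to ordered pairs of vertices: the value of \<open>w\<close> with
  \<open>p\<close> left out belongs to the branch of \<open>w\<close> seen from \<open>p\<close>,
  and no root is chosen. Labels strictly decrease along dependencies, so the number of rounds is
  bounded by the largest label, hence by the number of vertices, whatever the shape of the branches.

  The single number \<open>a\<close> is the only information that crosses the cut. This is what
  makes it affordable to try all its values instead of all labellings of the cycle.

  Every test of the algorithm becomes a count or a comparison over indices below the number of
  vertices. The program is therefore assembled from bounded sums and two tables filled row by row,
  and correctness and cost of such programs are proved once for all expressions.\<close>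

definition reach_avoiding :: "('a \<Rightarrow> 'a \<Rightarrow> bool) \<Rightarrow> 'a \<Rightarrow> 'a \<Rightarrow> 'a \<Rightarrow> bool" where
  "reach_avoiding R p = (\<lambda>y z. R y z \<and> z \<noteq> p)\<^sup>*\<^sup>*"

text \<open>For symmetric irreflexive \<open>R\<close> this means that \<open>{w, x}\<close> lies on
  a cycle. Avoiding a vertex instead of an edge turns it into a statement about branches: in a
  forest no two neighbours of \<open>w\<close> are joined without passing \<open>w\<close>.\<close>

definition cycle_edge :: "('a \<Rightarrow> 'a \<Rightarrow> bool) \<Rightarrow> 'a \<Rightarrow> 'a \<Rightarrow> bool" where
  "cycle_edge R w x \<longleftrightarrow> R w x \<and> (\<exists>u. u \<noteq> x \<and> R w u \<and> reach_avoiding R w u x)"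

lemma reach_avoiding_refl [simp]: "reach_avoiding R p u u"
  by (simp add: reach_avoiding_def)

lemma reach_avoiding_step: "reach_avoiding R p u y \<Longrightarrow> R y z \<Longrightarrow> z \<noteq> p \<Longrightarrow> reach_avoiding R p u z"
  unfolding reach_avoiding_def by (rule rtranclp.rtrancl_into_rtrancl) auto

lemma reach_avoiding_trans:
  "reach_avoiding R p u y \<Longrightarrow> reach_avoiding R p y z \<Longrightarrow> reach_avoiding R p u z"
  unfolding reach_avoiding_def by (rule rtranclp_trans)

text \<open>Only the targets of the steps are barred from \<open>p\<close>, so the start has to be
  excluded separately. With \<open>p = u\<close> the notion describes a walk that never returns to
  its start, which is the case of a message with no excluded neighbour.\<close>

lemma reach_avoiding_neq: "reach_avoiding R p u x \<Longrightarrow> u \<noteq> p \<Longrightarrow> x \<noteq> p"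
  unfolding reach_avoiding_def by (induction rule: rtranclp_induct) auto

lemma reach_avoiding_rtranclp: "reach_avoiding R p u x \<Longrightarrow> R\<^sup>*\<^sup>* u x"
  unfolding reach_avoiding_def by (erule rtranclp_mono[THEN predicate2D, rotated]) auto

lemma reach_avoiding_sym:
  assumes "symp R" "u \<noteq> p" "reach_avoiding R p u x"
  shows "reach_avoiding R p x u"
  using assms(3) unfolding reach_avoiding_def
proof (induction rule: rtranclp_induct)
  case (step y z)
  then have "y \<noteq> p" using reach_avoiding_neq assms(2) unfolding reach_avoiding_def by metis
  then have "(\<lambda>y z. R y z \<and> z \<noteq> p) z y" using step assms(1) by (auto dest: sympD)
  then show ?case using step.IH by (rule converse_rtranclp_into_rtranclp)
qed simp

lemma rtranclp_symp: "symp R \<Longrightarrow> R\<^sup>*\<^sup>* x y \<Longrightarrow> R\<^sup>*\<^sup>* y x"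
  by (metis rtranclp_converseD symp_conv_conversep_eq)

text \<open>Cut the walk at its last visit to \<open>s\<close>: each return to \<open>s\<close>
  starts the induction afresh.\<close>

lemma last_departure:
  assumes "R\<^sup>*\<^sup>* s w" "w \<noteq> s"
  shows "\<exists>x. R s x \<and> x \<noteq> s \<and> reach_avoiding R s x w"
  using assms
proof (induction rule: rtranclp_induct)
  case (step y z)
  show ?case
  proof (cases "y = s")
    case False
    then show ?thesis using step reach_avoiding_step by metis
  qed (use step in \<open>auto intro!: exI[of _ z]\<close>)
qed simp

lemma cycle_edge_sym:
  assumes "symp R" "irreflp R" "cycle_edge R s x"
  shows "cycle_edge R x s"
proof -
  obtain u where u: "R s x" "u \<noteq> x" "R s u" "reach_avoiding R s u x"
    using assms(3) by (auto simp: cycle_edge_def)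
  have ne: "u \<noteq> s" "x \<noteq> s" using u assms(2) by (auto dest: irreflpD)
  have "reach_avoiding R s x u" using reach_avoiding_sym[OF assms(1) ne(1) u(4)] .
  \<comment> \<open>The last departure from \<open>x\<close> is taken inside the relation that
    already avoids \<open>s\<close>, so the remaining walk avoids both vertices and its first step
    does not go to \<open>s\<close>.\<close>
  then obtain y where y: "R x y" "y \<noteq> s" "reach_avoiding (\<lambda>y z. R y z \<and> z \<noteq> s) x y u"
    using last_departure[of "\<lambda>y z. R y z \<and> z \<noteq> s" x u] u(2) unfolding reach_avoiding_def by auto
  have "reach_avoiding R x y u"
    using y(3) unfolding reach_avoiding_def by (rule rtranclp_mono[THEN predicate2D, rotated]) auto
  then have "reach_avoiding R x y s"
    by (rule reach_avoiding_step) (use u ne assms(1) in \<open>auto dest: sympD\<close>)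
  then show ?thesis using u y assms(1) unfolding cycle_edge_def by (auto dest: sympD)
qed

section \<open>Cycles as edge sets versus cycle edges\<close>

definition cycle_edges :: "'a list \<Rightarrow> 'a set set" where
  "cycle_edges xs = {{xs ! i, xs ! (Suc i mod length xs)} | i. i < length xs}"

lemma simple_path:
  assumes "R\<^sup>*\<^sup>* u x"
  shows "\<exists>xs. xs \<noteq> [] \<and> distinct xs \<and> hd xs = u \<and> last xs = x \<and> successively R xs \<and> (\<forall>y\<in>set xs. R\<^sup>*\<^sup>* u y)"
  using assms
proof (induction rule: rtranclp_induct)
  case base
  show ?case by (intro exI[of _ "[u]"]) simp
next
  case (step y z)
  then obtain xs where xs: "xs \<noteq> []" "distinct xs" "hd xs = u" "last xs = y" "successively R xs" "\<forall>y\<in>set xs. R\<^sup>*\<^sup>* u y"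
    by blast
  show ?case
  proof (cases "z \<in> set xs")
    case True
    then obtain ys zs where "xs = ys @ z # zs" by (meson split_list)
    then show ?thesis using xs
      by (intro exI[of _ "ys @ [z]"]) (auto simp: successively_append_iff hd_append)
  next
    case False
    then show ?thesis using xs step
      by (intro exI[of _ "xs @ [z]"]) (auto simp: successively_append_iff)
  qed
qed

lemma successively_nth: "successively R xs \<Longrightarrow> Suc i < length xs \<Longrightarrow> R (xs ! i) (xs ! Suc i)"
  by (simp add: successively_conv_nth)

lemma cycle_edges_related:
  assumes "successively R ys" "R (last ys) (hd ys)" "e \<in> cycle_edges ys"
  shows "\<exists>y z. e = {y, z} \<and> R y z"
proof -
  obtain i where i: "i < length ys" "e = {ys ! i, ys ! (Suc i mod length ys)}"
    using assms(3) by (auto simp: cycle_edges_def)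
  show ?thesis
  proof (cases "Suc i = length ys")
    case True
    then have ne: "ys \<noteq> []" and last: "i = length ys - 1" by auto
    have "ys ! i = last ys" unfolding last last_conv_nth[OF ne] ..
    moreover have "ys ! (Suc i mod length ys) = hd ys" unfolding True hd_conv_nth[OF ne] by simp
    ultimately
    show ?thesis using i assms(2) by metis
  next
    case False
    then show ?thesis using i successively_nth[OF assms(1), of i] by auto
  qed
qed

text \<open>A simple path from \<open>u\<close> to \<open>x\<close> avoiding \<open>w\<close> is
  closed up through \<open>w\<close>; \<open>u \<noteq> x\<close> supplies the third vertex.\<close>

lemma cycle_edge_cycle:
  assumes "symp R" "irreflp R" "cycle_edge R w x"
  shows "\<exists>ys. distinct ys \<and> 3 \<le> length ys \<and> {w, x} \<in> cycle_edges ys \<and>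
    (\<forall>e\<in>cycle_edges ys. \<exists>y z. e = {y, z} \<and> R y z)"
proof -
  obtain u where u: "R w x" "u \<noteq> x" "R w u" "reach_avoiding R w u x"
    using assms(3) by (auto simp: cycle_edge_def)
  have "u \<noteq> w" using u assms(2) by (auto dest: irreflpD)
  obtain xs where xs: "xs \<noteq> []" "distinct xs" "hd xs = u" "last xs = x"
      "successively (\<lambda>y z. R y z \<and> z \<noteq> w) xs" "\<forall>y\<in>set xs. reach_avoiding R w u y"
    using simple_path[OF u(4)[unfolded reach_avoiding_def]] unfolding reach_avoiding_def by blast
  have "w \<notin> set xs" using xs(6) reach_avoiding_neq \<open>u \<noteq> w\<close> by metis
  moreover have "2 \<le> length xs" using xs(1-4) u(2) by (cases xs; cases "tl xs") auto
  moreover have "successively R xs" using xs(5) by (rule successively_mono) auto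
  then have "successively R (w # xs)" using xs u(3) by (auto simp: successively_Cons)
  moreover have "R (last (w # xs)) (hd (w # xs))" using xs u(1) assms(1) by (auto dest: sympD)
  moreover have "{w, x} \<in> cycle_edges (w # xs)"
    unfolding cycle_edges_def using xs(1,4)
    by (intro CollectI exI[of _ "length xs"]) (auto simp: last_conv_nth nth_Cons')
  ultimately show ?thesis using xs(2) cycle_edges_related[of R "w # xs"]
    by (intro exI[of _ "w # xs"]) auto
qed

lemma adjacent_symp: "symp (adjacent G)"
  by (rule sympI) (simp add: adjacent_def insert_commute)

lemma adjacent_irreflp: "simple_graph G \<Longrightarrow> irreflp (adjacent G)"
  by (rule irreflpI) (auto simp: adjacent_def simple_graph_def doubleton_eq_iff)

lemma adjacent_verts: "simple_graph G \<Longrightarrow> adjacent G u v \<Longrightarrow> u \<in> verts G \<and> v \<in> verts G"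
  by (auto simp: adjacent_def simple_graph_def doubleton_eq_iff)

lemma is_cycle_cycle_edges:
  "is_cycle G C \<longleftrightarrow> C \<subseteq> edges G \<and> (\<exists>xs. distinct xs \<and> 3 \<le> length xs \<and> C = cycle_edges xs)"
  by (simp add: is_cycle_def cycle_edges_def)

text \<open>Allowing a subrelation \<open>R\<close> of adjacency serves both the whole graph and the
  cut one. That all edges of \<open>C\<close> come from \<open>R\<close> is what tells the cycles of
  the two apart.\<close>

lemma subgraph_cycle:
  assumes "symp R" "irreflp R" "cycle_edge R w x" "\<And>y z. R y z \<Longrightarrow> adjacent G y z"
  shows "\<exists>C. is_cycle G C \<and> {w, x} \<in> C \<and> (\<forall>e\<in>C. \<exists>y z. e = {y, z} \<and> R y z)"
proof -
  obtain ys where ys: "distinct ys" "3 \<le> length ys" "{w, x} \<in> cycle_edges ys"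
      "\<forall>e\<in>cycle_edges ys. \<exists>y z. e = {y, z} \<and> R y z"
    using cycle_edge_cycle[OF assms(1-3)] by blast
  have "cycle_edges ys \<subseteq> edges G"
  proof
    fix e assume "e \<in> cycle_edges ys"
    then obtain y z where "e = {y, z}" "R y z" using ys(4) by blast
    then show "e \<in> edges G" using assms(4)[of y z] by (simp add: adjacent_def)
  qed
  then have "is_cycle G (cycle_edges ys)" unfolding is_cycle_cycle_edges using ys(1,2) by blast
  then show ?thesis using ys(3,4) by blast
qed

lemma is_cycle_cycle_edge:
  assumes "is_cycle G C"
  shows "\<exists>w x. cycle_edge (adjacent G) w x"
proof -
  obtain xs where xs: "distinct xs" "3 \<le> length xs" "cycle_edges xs \<subseteq> edges G"
    using assms by (auto simp: is_cycle_cycle_edges)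
  let ?m = "length xs - 1"
  have adj: "adjacent G (xs ! i) (xs ! (Suc i mod length xs))" if "i < length xs" for i
    using xs(3) that by (auto simp: cycle_edges_def adjacent_def)
  have "reach_avoiding (adjacent G) (xs ! 0) (xs ! 1) (xs ! Suc i)" if "Suc i < length xs" for i
    using that
  proof (induction i)
    case (Suc i)
    have "xs ! Suc (Suc i) \<noteq> xs ! 0" using xs(1) Suc.prems by (subst nth_eq_iff_index_eq) auto
    then show ?case using Suc adj[of "Suc i"] by (intro reach_avoiding_step[OF Suc.IH]) auto
  qed simp
  \<comment> \<open>The path from index 1 to the last index avoids vertex 0; its ends are the two
    distinct neighbours that \<open>cycle_edge\<close> asks for.\<close>
  from this[of "length xs - 2"] have "reach_avoiding (adjacent G) (xs ! 0) (xs ! 1) (xs ! ?m)"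
    using xs(2) by (simp add: Suc_diff_le numeral_2_eq_2 Suc_diff_Suc)
  moreover have "xs ! 1 \<noteq> xs ! ?m" using xs(1,2) by (subst nth_eq_iff_index_eq) auto
  moreover have "0 < length xs" "Suc 0 mod length xs = 1" using xs(2) by auto
  then have "adjacent G (xs ! 0) (xs ! 1)" using adj[of 0] by simp
  moreover have "Suc ?m = length xs" using xs(2) by simp
  then have "adjacent G (xs ! ?m) (xs ! 0)" using adj[of ?m] xs(2) by simp
  then have "adjacent G (xs ! 0) (xs ! ?m)" by (rule sympD[OF adjacent_symp])
  ultimately show ?thesis unfolding cycle_edge_def by blast
qed

text \<open>In a unicyclic graph with \<open>s\<close> on the cycle this deletes its two cycle edges
  at \<open>s\<close>. Naming them through \<open>cycle_edge\<close> avoids choosing the two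
  neighbours and can be tested by the program.\<close>

definition cut_cycle :: "('a \<Rightarrow> 'a \<Rightarrow> bool) \<Rightarrow> 'a \<Rightarrow> 'a \<Rightarrow> 'a \<Rightarrow> bool" where
  "cut_cycle R s = (\<lambda>y z. R y z \<and> \<not> (y = s \<and> cycle_edge R s z) \<and> \<not> (z = s \<and> cycle_edge R s y))"

lemma cut_cycle_symp: "symp R \<Longrightarrow> symp (cut_cycle R s)"
  by (auto simp: cut_cycle_def symp_def)

lemma cut_cycle_irreflp: "irreflp R \<Longrightarrow> irreflp (cut_cycle R s)"
  by (auto simp: cut_cycle_def irreflp_def)

text \<open>A cycle surviving the cut would be the unique cycle of \<open>G\<close>, but that one
  contains the deleted edge \<open>{s, x}\<close>.\<close>

lemma cut_forest:
  assumes "unicyclic G" "cycle_edge (adjacent G) s x"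
  shows "\<not> cycle_edge (cut_cycle (adjacent G) s) w y"
proof
  let ?R = "adjacent G" and ?H = "cut_cycle (adjacent G) s"
  assume H: "cycle_edge ?H w y"
  have R: "symp ?R" "irreflp ?R" using assms(1) by (auto simp: unicyclic_def adjacent_symp adjacent_irreflp)
  obtain C where C: "is_cycle G C" "{s, x} \<in> C" using subgraph_cycle[OF R assms(2)] by blast
  obtain C' where C': "is_cycle G C'" "\<forall>e\<in>C'. \<exists>y z. e = {y, z} \<and> ?H y z"
    using subgraph_cycle[OF cut_cycle_symp[OF R(1)] cut_cycle_irreflp[OF R(2)] H, of G] by (auto simp: cut_cycle_def)
  have "C = C'" using assms(1) C C' by (auto simp: unicyclic_def)
  then obtain y z where "{s, x} = {y, z}" "?H y z" using C C' by blast
  then show False using assms(2) by (auto simp: cut_cycle_def doubleton_eq_iff)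
qed

text \<open>If \<open>s\<close> still reached \<open>w\<close>, its last departure would use a
  surviving edge to some \<open>x\<close> joined to \<open>w\<close> without \<open>s\<close>. Then
  \<open>{s, x}\<close> is a cycle edge and was deleted. So nothing in the component of
  \<open>s\<close> enjoys the free label.\<close>

lemma cut_separates:
  assumes "symp R" "irreflp R" "cycle_edge R s w"
  shows "\<not> (cut_cycle R s)\<^sup>*\<^sup>* s w"
proof
  assume "(cut_cycle R s)\<^sup>*\<^sup>* s w"
  moreover have "w \<noteq> s" using assms by (auto simp: cycle_edge_def dest: irreflpD)
  ultimately obtain x where x: "cut_cycle R s s x" "x \<noteq> s" "reach_avoiding (cut_cycle R s) s x w"
    using last_departure by metis
  have "reach_avoiding R s x w"
    using x(3) unfolding reach_avoiding_def by (rule rtranclp_mono[THEN predicate2D, rotated]) (auto simp: cut_cycle_def)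
  then have "reach_avoiding R s w x" by (rule reach_avoiding_sym[OF assms(1) x(2)])
  moreover have "w \<noteq> x" using x(1) assms(3) by (auto simp: cut_cycle_def)
  ultimately have "cycle_edge R s x" using x(1) assms(3) unfolding cycle_edge_def cut_cycle_def by blast
  then show False using x(1) by (simp add: cut_cycle_def)
qed

section \<open>Labellings and messages\<close>

definition trans_labelling :: "'a set \<Rightarrow> ('a \<Rightarrow> 'a \<Rightarrow> bool) \<Rightarrow> ('a \<Rightarrow> nat) \<Rightarrow> bool" where
  "trans_labelling V R c \<longleftrightarrow>
     (\<forall>x\<in>V. 1 \<le> c x \<and> (\<forall>i. 1 \<le> i \<and> i < c x \<longrightarrow> (\<exists>y\<in>V. R x y \<and> c y = i)))"

text \<open>Hall's condition for realizing the labels \<open>1, ..., j - 1\<close>, where \<open>cnt i\<close> is the number of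
  neighbours that can carry a label at least \<open>i\<close> (and hence also every smaller label), and \<open>b\<close> says
  whether the label \<open>a\<close> is available for free.\<close>

definition feasible :: "(nat \<Rightarrow> nat) \<Rightarrow> bool \<Rightarrow> nat \<Rightarrow> nat \<Rightarrow> bool" where
  "feasible cnt b a j \<longleftrightarrow>
     (\<forall>i. 1 \<le> i \<and> i < j \<longrightarrow> j \<le> i + cnt i + (if b \<and> i \<le> a \<and> a < j then 1 else 0))"

text \<open>\<^term>\<open>msg V H N a t w p\<close> is the largest label that \<open>w\<close> can receive without help from its
  neighbour \<open>p\<close>, when the vertices in \<open>N\<close> get a neighbour with label \<open>a\<close> for free and \<open>t\<close> is at least
  the depth of the dependencies.  The choice \<open>p = w\<close> means that all neighbours may help.\<close>

primrec msg :: "'a set \<Rightarrow> ('a \<Rightarrow> 'a \<Rightarrow> bool) \<Rightarrow> ('a \<Rightarrow> bool) \<Rightarrow> nat \<Rightarrow> nat \<Rightarrow> 'a \<Rightarrow> 'a \<Rightarrow> nat" where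
  "msg V H N a 0 = (\<lambda>w p. 0)"
| "msg V H N a (Suc t) = (\<lambda>w p. card {j. j < card V \<and>
     feasible (\<lambda>i. card {u \<in> V. H w u \<and> u \<noteq> p \<and> i \<le> msg V H N a t u w}) (N w) a (Suc j)})"

lemma feasible_mono: "feasible cnt b a j \<Longrightarrow> j' \<le> j \<Longrightarrow> feasible cnt b a j'"
  unfolding feasible_def
proof (intro allI impI)
  fix i assume *: "\<forall>i. 1 \<le> i \<and> i < j \<longrightarrow> j \<le> i + cnt i + (if b \<and> i \<le> a \<and> a < j then 1 else 0)"
    "j' \<le> j" "1 \<le> i \<and> i < j'"
  then have "j \<le> i + cnt i + (if b \<and> i \<le> a \<and> a < j then 1 else 0)" by auto
  \<comment> \<open>Lowering \<open>j\<close> may lose the bonus for the free label, but then the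
    left side has dropped by at least one too.\<close>
  then show "j' \<le> i + cnt i + (if b \<and> i \<le> a \<and> a < j' then 1 else 0)" using *(2,3) by (auto split: if_splits)
qed

text \<open>By \<open>feasible_mono\<close> the feasible labels form an initial segment, so their
  number is the largest of them. This is why \<open>msg\<close> counts instead of taking a maximum:
  a count is a bounded sum.\<close>

lemma feasible_card_iff:
  assumes "1 \<le> j" "j \<le> n"
  shows "j \<le> card {j. j < n \<and> feasible cnt b a (Suc j)} \<longleftrightarrow> feasible cnt b a j"
proof
  let ?D = "{j. j < n \<and> feasible cnt b a (Suc j)}"
  show "feasible cnt b a j" if "j \<le> card ?D"
  proof (rule ccontr)
    assume not: "\<not> feasible cnt b a j"
    have "?D \<subseteq> {..<j - 1}"
    proof
      fix i assume "i \<in> ?D"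
      then have "\<not> j \<le> Suc i" using feasible_mono not by blast
      then show "i \<in> {..<j - 1}" by auto
    qed
    then have "card ?D \<le> j - 1" using card_mono[of "{..<j - 1}"] by auto
    then show False using that assms by simp
  qed
  show "j \<le> card ?D" if "feasible cnt b a j"
  proof -
    have "{..<j} \<subseteq> ?D" using that assms feasible_mono[OF that] by auto
    then show ?thesis using card_mono[of ?D "{..<j}"] by auto
  qed
qed

lemma msg_le: "msg V H N a t w p \<le> card V"
proof (cases t)
  case (Suc t)
  have "card {j. j < card V \<and> Q j} \<le> card V" for Q
    using card_mono[of "{..<card V}" "{j. j < card V \<and> Q j}"] by auto
  then show ?thesis by (simp add: Suc)
qed simp

section \<open>Realizing messages by labellings\<close>

text \<open>Hall's condition suffices for a system of distinct representatives when the sets of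
  representatives are nested.\<close>

lemma nested_hall:
  fixes x :: "'a \<Rightarrow> nat"
  assumes "finite L" "finite U" "\<And>l. l \<in> L \<Longrightarrow> card {l'\<in>L. l \<le> l'} \<le> card {u\<in>U. l \<le> x u}"
  shows "\<exists>g. inj_on g L \<and> g ` L \<subseteq> U \<and> (\<forall>l\<in>L. l \<le> x (g l))"
  using assms
proof (induction "card L" arbitrary: L U)
  case 0
  then show ?case by simp
next
  case (Suc k)
  define m where "m = Max L"
  have L: "L \<noteq> {}" using Suc by auto
  have m: "m \<in> L" "\<And>l. l \<in> L \<Longrightarrow> l \<le> m" using Suc.prems L by (auto simp: m_def)
  have "{l'\<in>L. m \<le> l'} \<noteq> {}" using m by auto
  then have "0 < card {l'\<in>L. m \<le> l'}" using Suc.prems by (simp add: card_gt_0_iff)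
  then have "{u\<in>U. m \<le> x u} \<noteq> {}" using Suc.prems(3)[OF m(1)] by (metis card.empty not_less0 le_zero_eq neq0_conv)
  \<comment> \<open>The largest demand goes to any \<open>v\<close> able to meet it. Such a
    \<open>v\<close> is counted for every \<open>l\<close> in \<open>L\<close>, so removing it
    together with \<open>m\<close> lowers both sides of each inequality by one.\<close>
  then obtain v where v: "v \<in> U" "m \<le> x v" by auto
  have "\<exists>g. inj_on g (L - {m}) \<and> g ` (L - {m}) \<subseteq> U - {v} \<and> (\<forall>l\<in>L - {m}. l \<le> x (g l))"
  proof (rule Suc.hyps(1))
    show "k = card (L - {m})" using Suc.hyps(2) Suc.prems m by simp
    fix l assume l: "l \<in> L - {m}"
    have "{l' \<in> L - {m}. l \<le> l'} = {l'\<in>L. l \<le> l'} - {m}" by auto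
    moreover have "{u \<in> U - {v}. l \<le> x u} = {u\<in>U. l \<le> x u} - {v}" by auto
    moreover have "m \<in> {l'\<in>L. l \<le> l'}" "v \<in> {u\<in>U. l \<le> x u}" using l m(1) m(2)[of l] v by auto
    ultimately show "card {l' \<in> L - {m}. l \<le> l'} \<le> card {u \<in> U - {v}. l \<le> x u}"
      using Suc.prems(3)[of l] l Suc.prems(1,2) by simp
  qed (use Suc.prems in auto)
  then obtain g where g: "inj_on g (L - {m})" "g ` (L - {m}) \<subseteq> U - {v}" "\<forall>l\<in>L - {m}. l \<le> x (g l)" by blast
  have "inj_on (g(m := v)) L" using g(1,2) unfolding inj_on_def by auto
  then show ?case using g v by (intro exI[of _ "g(m := v)"]) auto
qed

text \<open>Witnesses are sought inside \<open>S\<close>, so the labelling of \<open>S\<close> is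
  self-contained except for the free label. Hence labellings of disjoint sets can be glued and all
  other vertices can be ignored.\<close>

definition partial_labelling :: "('a \<Rightarrow> 'a \<Rightarrow> bool) \<Rightarrow> ('a \<Rightarrow> bool) \<Rightarrow> nat \<Rightarrow> 'a set \<Rightarrow> ('a \<Rightarrow> nat) \<Rightarrow> bool" where
  "partial_labelling H N a S c \<longleftrightarrow>
     (\<forall>x\<in>S. 1 \<le> c x \<and> (\<forall>i. 1 \<le> i \<and> i < c x \<longrightarrow> N x \<and> i = a \<or> (\<exists>y\<in>S. H x y \<and> c y = i)))"

text \<open>Hall's condition picks distinct neighbours of \<open>w\<close>, the induction labels
  their branches away from \<open>w\<close>, and the forest property keeps these branches disjoint.
  The clause confining \<open>S\<close> to the part reached from \<open>w\<close> without
  \<open>p\<close> is what permits the gluing one level up.\<close>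

lemma msg_sound:
  assumes H: "symp H" "irreflp H" "\<And>y z. H y z \<Longrightarrow> y \<in> V \<and> z \<in> V" "finite V"
    and forest: "\<And>w x. \<not> cycle_edge H w x"
  shows "w \<in> V \<Longrightarrow> p = w \<or> H w p \<Longrightarrow> 1 \<le> j \<Longrightarrow> j \<le> msg V H N a t w p \<Longrightarrow>
    \<exists>S c. w \<in> S \<and> (\<forall>x\<in>S. reach_avoiding H p w x) \<and> c w = j \<and> partial_labelling H N a S c"
proof (induction t arbitrary: w p j)
  case 0
  then show ?case by simp
next
  case (Suc t)
  define U where "U = {u \<in> V. H w u \<and> u \<noteq> p}"
  define L where "L = {1..<j} - (if N w then {a} else {})"
  have "j \<le> card V" using Suc.prems(4) msg_le[of V H N a "Suc t" w p] by (rule le_trans)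
  then have feas: "feasible (\<lambda>i. card {u \<in> V. H w u \<and> u \<noteq> p \<and> i \<le> msg V H N a t u w}) (N w) a j"
    using Suc.prems(4) unfolding msg.simps by (rule feasible_card_iff[OF Suc.prems(3), THEN iffD1])
  have "\<exists>g. inj_on g L \<and> g ` L \<subseteq> U \<and> (\<forall>l\<in>L. l \<le> msg V H N a t (g l) w)"
  proof (rule nested_hall)
    fix l assume l: "l \<in> L"
    then have l': "1 \<le> l" "l < j" by (auto simp: L_def)
    have "{l'\<in>L. l \<le> l'} = {l..<j} - (if N w then {a} else {})" using l' by (auto simp: L_def)
    \<comment> \<open>The bonus in \<open>feasible\<close> is the label missing from the demand
      \<open>L\<close>: it matters exactly when \<open>a\<close> lies in
      \<open>{l..<j}\<close>.\<close>
    then have "card {l'\<in>L. l \<le> l'} = j - l - (if N w \<and> l \<le> a \<and> a < j then 1 else 0)"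
      by (auto simp: card_Diff_singleton_if)
    moreover have "j \<le> l + card {u \<in> V. H w u \<and> u \<noteq> p \<and> l \<le> msg V H N a t u w} +
        (if N w \<and> l \<le> a \<and> a < j then 1 else 0)"
      using feas l' unfolding feasible_def by blast
    moreover have "{u\<in>U. l \<le> msg V H N a t u w} = {u \<in> V. H w u \<and> u \<noteq> p \<and> l \<le> msg V H N a t u w}"
      by (auto simp: U_def)
    then have "card {u\<in>U. l \<le> msg V H N a t u w} = card {u \<in> V. H w u \<and> u \<noteq> p \<and> l \<le> msg V H N a t u w}"
      by (rule arg_cong)
    ultimately show "card {l'\<in>L. l \<le> l'} \<le> card {u\<in>U. l \<le> msg V H N a t u w}"
      by linarith
  qed (use H in \<open>auto simp: L_def U_def\<close>)
  then obtain g where g: "inj_on g L" "g ` L \<subseteq> U" "\<And>l. l \<in> L \<Longrightarrow> l \<le> msg V H N a t (g l) w" by blast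
  have gU: "g l \<in> V" "H w (g l)" "g l \<noteq> p" "g l \<noteq> w" if "l \<in> L" for l
    using g(2) that H(2) by (auto simp: U_def dest: irreflpD)
  have "\<exists>S c. g l \<in> S \<and> (\<forall>x\<in>S. reach_avoiding H w (g l) x) \<and> c (g l) = l \<and> partial_labelling H N a S c" if "l \<in> L" for l
    using that gU[OF that] g(3)[OF that] H(1) by (intro Suc.IH) (auto simp: L_def dest: sympD)
  then obtain S c where Sc: "\<And>l. l \<in> L \<Longrightarrow> g l \<in> S l" "\<And>l x. l \<in> L \<Longrightarrow> x \<in> S l \<Longrightarrow> reach_avoiding H w (g l) x"
     "\<And>l. l \<in> L \<Longrightarrow> c l (g l) = l" "\<And>l. l \<in> L \<Longrightarrow> partial_labelling H N a (S l) (c l)" by metis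
  have nw: "w \<notin> S l" if "l \<in> L" for l
    using reach_avoiding_neq[OF Sc(2)[OF that]] gU(4)[OF that] by blast
  have disj: "l = l'" if "l \<in> L" "l' \<in> L" "x \<in> S l" "x \<in> S l'" for l l' x
  proof (rule ccontr)
    assume "l \<noteq> l'"
    then have ne: "g l \<noteq> g l'" using g(1) that by (auto dest: inj_onD)
    \<comment> \<open>A common vertex would join two different neighbours of \<open>w\<close>
      without passing \<open>w\<close>, which a forest forbids.\<close>
    have "reach_avoiding H w (g l) (g l')"
      using Sc(2)[OF that(1,3)] reach_avoiding_sym[OF H(1) gU(4)[OF that(2)] Sc(2)[OF that(2,4)]] by (rule reach_avoiding_trans)
    then show False using forest[of w "g l'"] ne gU that unfolding cycle_edge_def by blast
  qed
  have away: "reach_avoiding H p w x" if "l \<in> L" "x \<in> S l" for l x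
  proof -
    \<comment> \<open>A branch containing \<open>p\<close> would join \<open>g l\<close> to the
      neighbour \<open>p\<close> of \<open>w\<close> without passing \<open>w\<close>, again a
      cycle.\<close>
    have "p \<noteq> y" if "reach_avoiding H w (g l) y" for y
    proof
      assume "p = y"
      then have py: "reach_avoiding H w (g l) p" using that by simp
      then have "p \<noteq> w" using reach_avoiding_neq gU(4)[OF \<open>l \<in> L\<close>] by metis
      then have "H w p" using Suc.prems(2) by simp
      then show False using forest[of w p] py gU[OF \<open>l \<in> L\<close>] unfolding cycle_edge_def by blast
    qed
    moreover have "reach_avoiding H w (g l) x" using Sc(2) that by blast
    then have "(\<lambda>y z. H y z \<and> z \<noteq> w)\<^sup>*\<^sup>* (g l) x" by (simp add: reach_avoiding_def)
    then have "reach_avoiding H p w x"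
    proof (induction rule: rtranclp_induct)
      case base
      show ?case using gU[OF that(1)] by (intro reach_avoiding_step[OF reach_avoiding_refl])
    next
      case (step y z)
      have "reach_avoiding H w (g l) z" using step(1,2) unfolding reach_avoiding_def by (rule rtranclp.rtrancl_into_rtrancl)
      then have "z \<noteq> p" using calculation by blast
      then show ?case using step by (intro reach_avoiding_step[OF step(3)]) auto
    qed
    ultimately show ?thesis by blast
  qed
  define S' where "S' = insert w (\<Union>l\<in>L. S l)"
  define c' where "c' = (\<lambda>x. if x = w then j else c (THE l. l \<in> L \<and> x \<in> S l) x)"
  have c': "c' x = c l x" if "l \<in> L" "x \<in> S l" for l x
  proof -
    have "(THE l. l \<in> L \<and> x \<in> S l) = l" using that disj by (intro the_equality) auto
    then show ?thesis using nw[OF that(1)] that(2) by (auto simp: c'_def)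
  qed
  have "partial_labelling H N a S' c'"
    unfolding partial_labelling_def
  proof
    fix x assume "x \<in> S'"
    then consider "x = w" | l where "l \<in> L" "x \<in> S l" by (auto simp: S'_def)
    then show "1 \<le> c' x \<and> (\<forall>i. 1 \<le> i \<and> i < c' x \<longrightarrow> N x \<and> i = a \<or> (\<exists>y\<in>S'. H x y \<and> c' y = i))"
    proof cases
      case 1
      have "N w \<and> i = a \<or> (\<exists>y\<in>S'. H w y \<and> c' y = i)" if "1 \<le> i" "i < j" for i
      proof (cases "i \<in> L")
        case True
        then have "g i \<in> S'" "H w (g i)" "c' (g i) = i"
          using Sc(1,3)[OF True] gU(2)[OF True] c'[OF True] by (auto simp: S'_def)
        then show ?thesis by blast
      next
        case False
        then show ?thesis using that by (auto simp: L_def split: if_splits)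
      qed
      then show ?thesis using 1 Suc.prems(3) by (simp add: c'_def)
    next
      case 2
      then have *: "1 \<le> c l x" "\<And>i. 1 \<le> i \<Longrightarrow> i < c l x \<Longrightarrow> N x \<and> i = a \<or> (\<exists>y\<in>S l. H x y \<and> c l y = i)"
        using Sc(4)[OF 2(1)] by (auto simp: partial_labelling_def)
      have "N x \<and> i = a \<or> (\<exists>y\<in>S'. H x y \<and> c' y = i)" if "1 \<le> i" "i < c l x" for i
      proof -
        from *(2)[OF that] show ?thesis
        proof
          assume "\<exists>y\<in>S l. H x y \<and> c l y = i"
          then obtain y where "y \<in> S l" "H x y" "c l y = i" by blast
          then show ?thesis using c'[OF 2(1)] 2(1) by (auto simp: S'_def)
        qed blast
      qed
      then show ?thesis using *(1) c'[OF 2] by simp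
    qed
  qed
  moreover have "c' w = j" by (simp add: c'_def)
  moreover have "\<forall>x\<in>S'. reach_avoiding H p w x" using away by (auto simp: S'_def)
  ultimately show ?case by (intro exI[of _ S'] exI[of _ c']) (auto simp: S'_def)
qed

text \<open>\<open>S\<close> gives \<open>s\<close> the label \<open>a\<close> and, by
  \<open>cut_separates\<close>, never uses the free label. If \<open>v\<close> lies in the component
  of \<open>s\<close>, the same holds for \<open>T\<close>, and \<open>T\<close> alone suffices.
  Otherwise \<open>S\<close> and \<open>T\<close> are disjoint, and \<open>s\<close> really supplies
  the label that \<open>T\<close> took for free. All remaining vertices get label 1, which demands
  nothing.\<close>

lemma cut_sound:
  assumes R: "symp R" "irreflp R" "\<And>y z. R y z \<Longrightarrow> y \<in> V \<and> z \<in> V" "finite V"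
    and forest: "\<And>w x. \<not> cycle_edge (cut_cycle R s) w x"
    and s: "s \<in> V" "1 \<le> a" "a \<le> msg V (cut_cycle R s) (cycle_edge R s) a t s s"
    and v: "v \<in> V" "1 \<le> k" "k \<le> msg V (cut_cycle R s) (cycle_edge R s) a t v v"
  shows "\<exists>c. trans_labelling V R c \<and> c v = k"
proof -
  let ?H = "cut_cycle R s" and ?N = "cycle_edge R s"
  have H: "symp ?H" "irreflp ?H" "\<And>y z. ?H y z \<Longrightarrow> y \<in> V \<and> z \<in> V"
    using cut_cycle_symp[OF R(1)] cut_cycle_irreflp[OF R(2)] R(3) unfolding cut_cycle_def by blast+
  have sound: "\<exists>S c. w \<in> S \<and> (\<forall>x\<in>S. reach_avoiding ?H w w x) \<and> c w = j \<and> partial_labelling ?H ?N a S c"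
    if "w \<in> V" "1 \<le> j" "j \<le> msg V ?H ?N a t w w" for w j
    using that H forest R(4) by (intro msg_sound[where V = V and t = t]) auto
  obtain S c where S: "s \<in> S" "\<forall>x\<in>S. reach_avoiding ?H s s x" "c s = a" "partial_labelling ?H ?N a S c"
    using sound[OF s] by blast
  obtain T d where T: "v \<in> T" "\<forall>x\<in>T. reach_avoiding ?H v v x" "d v = k" "partial_labelling ?H ?N a T d"
    using sound[OF v] by blast
  have inV: "x \<in> V" if "?H\<^sup>*\<^sup>* u x" "u \<in> V" for u x
    using that by (induction rule: rtranclp_induct) (auto dest: H(3))
  have S': "?H\<^sup>*\<^sup>* s x" "x \<in> V" "\<not> ?N x" if "x \<in> S" for x
    using that S(2) reach_avoiding_rtranclp[of ?H s s x] inV s(1) cut_separates[OF R(1,2)] by blast+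
  have T': "?H\<^sup>*\<^sup>* v x" "x \<in> V" if "x \<in> T" for x
    using that T(2) reach_avoiding_rtranclp[of ?H v v x] inV v(1) by blast+
  have HR: "R y z" if "?H y z" for y z using that by (simp add: cut_cycle_def)
  show ?thesis
  proof (cases "?H\<^sup>*\<^sup>* s v")
    case True
    have noN: "\<not> ?N x" if "x \<in> T" for x
      using True T'(1)[OF that] cut_separates[OF R(1,2)] by (meson rtranclp_trans)
    have "trans_labelling V R (\<lambda>x. if x \<in> T then d x else 1)"
      unfolding trans_labelling_def
    proof (intro ballI conjI allI impI)
      fix x show "1 \<le> (if x \<in> T then d x else 1)" using T(4) by (auto simp: partial_labelling_def)
      fix i assume "1 \<le> i \<and> i < (if x \<in> T then d x else 1)"
      then have x: "x \<in> T" "1 \<le> i" "i < d x" by (auto split: if_splits)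
      then obtain y where "y \<in> T" "?H x y" "d y = i" using T(4) noN unfolding partial_labelling_def by blast
      then show "\<exists>y\<in>V. R x y \<and> (if y \<in> T then d y else 1) = i"
        using T'(2) HR by (intro bexI[of _ y]) auto
    qed
    then show ?thesis using T by (intro exI[of _ "\<lambda>x. if x \<in> T then d x else 1"]) simp
  next
    case False
    have disj: "x \<notin> T" if "x \<in> S" for x
    proof
      assume "x \<in> T"
      then have "?H\<^sup>*\<^sup>* x v" using rtranclp_symp[OF H(1)] T'(1) by blast
      then show False using False S'(1)[OF that] by (meson rtranclp_trans)
    qed
    let ?c = "\<lambda>x. if x \<in> T then d x else if x \<in> S then c x else 1"
    have "trans_labelling V R ?c"
      unfolding trans_labelling_def
    proof (intro ballI conjI allI impI)
      fix x show "1 \<le> ?c x" using T(4) S(4) by (auto simp: partial_labelling_def)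
      fix i assume i: "1 \<le> i \<and> i < ?c x"
      then consider "x \<in> T" | "x \<in> S" by (auto split: if_splits)
      then show "\<exists>y\<in>V. R x y \<and> ?c y = i"
      proof cases
        case 1
        then have "?N x \<and> i = a \<or> (\<exists>y\<in>T. ?H x y \<and> d y = i)" using i T(4) by (auto simp: partial_labelling_def)
        then show ?thesis
        proof
          assume *: "?N x \<and> i = a"
          then have "R x s" using R(1) by (auto simp: cycle_edge_def dest: sympD)
          then show ?thesis using s(1) S(1,3) disj * by (intro bexI[of _ s]) auto
        next
          assume "\<exists>y\<in>T. ?H x y \<and> d y = i"
          then obtain y where "y \<in> T" "?H x y" "d y = i" by blast
          then show ?thesis using T'(2) HR by (intro bexI[of _ y]) auto
        qed
      next
        case 2
        then have "i < c x" using i disj by auto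
        then obtain y where "y \<in> S" "?H x y" "c y = i" using 2 i S(4) S'(3)[OF 2] unfolding partial_labelling_def by blast
        then show ?thesis using S'(2) HR disj by (intro bexI[of _ y]) auto
      qed
    qed
    then show ?thesis using T by (intro exI[of _ ?c]) simp
  qed
qed

text \<open>The witnesses in a given labelling have smaller labels than \<open>w\<close>. So the
  excluded \<open>p\<close> is not among them, and one round fewer suffices for each of
  them.\<close>

lemma msg_complete:
  assumes R: "symp R" "irreflp R" "\<And>y z. R y z \<Longrightarrow> y \<in> V \<and> z \<in> V" "finite V"
    and c: "trans_labelling V R c" "\<And>x. x \<in> V \<Longrightarrow> c x \<le> card V"
    and s: "\<And>x y. cycle_edge R x y \<Longrightarrow> c s \<le> c x"
  shows "w \<in> V \<Longrightarrow> p = w \<or> c w \<le> c p \<Longrightarrow> c w \<le> t \<Longrightarrow>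
     c w \<le> msg V (cut_cycle R s) (cycle_edge R s) (c s) t w p"
proof (induction t arbitrary: w p)
  case 0
  then show ?case by simp
next
  case (Suc t)
  let ?H = "cut_cycle R s" and ?N = "cycle_edge R s"
  let ?m = "msg V ?H ?N (c s) t"
  let ?U = "\<lambda>i. {u \<in> V. ?H w u \<and> u \<noteq> p \<and> i \<le> ?m u w}"
  have c1: "1 \<le> c w" using c(1) Suc.prems by (auto simp: trans_labelling_def)
  have "\<exists>u. u \<in> V \<and> R w u \<and> c u = l" if "1 \<le> l" "l < c w" for l
    using c(1) Suc.prems(1) that by (auto simp: trans_labelling_def)
  then obtain f where f: "\<And>l. 1 \<le> l \<Longrightarrow> l < c w \<Longrightarrow> f l \<in> V \<and> R w (f l) \<and> c (f l) = l" by metis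
  have "feasible (\<lambda>i. card (?U i)) (?N w) (c s) (c w)"
    unfolding feasible_def
  proof (intro allI impI)
    fix i assume i: "1 \<le> i \<and> i < c w"
    let ?L = "{i..<c w} - (if ?N w then {c s} else {})"
    have "f ` ?L \<subseteq> ?U i"
    proof
      fix u assume "u \<in> f ` ?L"
      then obtain l where "l \<in> ?L" and ul: "u = f l" by blast
      then have l: "u = f l" "i \<le> l" "l < c w" "\<not> (?N w \<and> l = c s)" by (auto split: if_splits)
      then have u: "u \<in> V" "R w u" "c u = l" using f[of l] i by auto
      have "u \<noteq> p" using u l Suc.prems(2) R(2) by (auto dest: irreflpD)
      \<comment> \<open>Minimality enters here: a witness of \<open>s\<close> across a deleted edge
        would have a cycle edge and a label below \<open>c s\<close>.\<close>
      moreover have "\<not> (w = s \<and> ?N u)"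
      proof
        assume *: "w = s \<and> ?N u"
        then have "cycle_edge R u s" using cycle_edge_sym[OF R(1,2)] by blast
        then show False using s[of u s] * u l by simp
      qed
      \<comment> \<open>In the other direction a deleted edge could only supply the label
        \<open>c s\<close>, which was left out of \<open>?L\<close>.\<close>
      moreover have "\<not> (u = s \<and> ?N w)" using u l by auto
      ultimately have "?H w u" "u \<noteq> p" using u by (auto simp: cut_cycle_def)
      moreover have "c u \<le> ?m u w" using u l Suc.prems by (intro Suc.IH) auto
      ultimately show "u \<in> ?U i" using u l by simp
    qed
    moreover have "inj_on f ?L" using f i by (intro inj_on_inverseI[of _ c]) auto
    moreover have "finite (?U i)" using R(4) by simp
    ultimately have "card ?L \<le> card (?U i)" using card_inj_on_le by blast
    moreover have "card ?L = c w - i - (if ?N w \<and> i \<le> c s \<and> c s < c w then 1 else 0)"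
      by (auto simp: card_Diff_singleton_if)
    ultimately show "c w \<le> i + card (?U i) + (if ?N w \<and> i \<le> c s \<and> c s < c w then 1 else 0)" by (auto split: if_splits)
  qed
  then show ?case unfolding msg.simps by (rule feasible_card_iff[OF c1 c(2)[OF Suc.prems(1)], THEN iffD2])
qed

section \<open>The upper domatic number\<close>

lemma vertex_partition_le_card:
  assumes "vertex_partition G k P" "finite (verts G)"
  shows "k \<le> card (verts G)"
proof -
  have "\<forall>i\<in>{1..k}. \<exists>x. x \<in> P i" using assms(1) by (auto simp: vertex_partition_def)
  then obtain f where f: "\<And>i. i \<in> {1..k} \<Longrightarrow> f i \<in> P i" by metis
  have "inj_on f {1..k}"
  proof (rule inj_onI)
    fix i j assume ij: "i \<in> {1..k}" "j \<in> {1..k}" "f i = f j"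
    then have "f i \<in> P i \<inter> P j" using f[of i] f[of j] by auto
    then show "i = j" using assms(1) ij unfolding vertex_partition_def disjoint_family_on_def by blast
  qed
  moreover have "f ` {1..k} \<subseteq> verts G" using f assms(1) unfolding vertex_partition_def by blast
  ultimately show ?thesis using card_inj_on_le[of f "{1..k}" "verts G"] assms(2) by simp
qed

text \<open>Demands below \<open>k\<close> are met by labels that the cap leaves alone. Capping at
  the label of a vertex yields a partition with exactly that many classes.\<close>

lemma trans_labelling_cap:
  assumes "trans_labelling V R c" "1 \<le> k"
  shows "trans_labelling V R (\<lambda>x. min (c x) k)"
  unfolding trans_labelling_def
proof (intro ballI conjI allI impI)
  fix x assume x: "x \<in> V"
  show "1 \<le> min (c x) k" using assms x by (auto simp: trans_labelling_def)
  fix i assume "1 \<le> i \<and> i < min (c x) k"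
  then show "\<exists>y\<in>V. R x y \<and> min (c y) k = i" using assms x by (force simp: trans_labelling_def)
qed

lemma partition_of_labelling:
  assumes c: "trans_labelling (verts G) (adjacent G) c" and v: "v \<in> verts G"
  shows "\<exists>P. transitive_partition G (c v) P"
proof
  define k where "k = c v"
  have k: "1 \<le> k" using c v by (auto simp: k_def trans_labelling_def)
  let ?d = "\<lambda>x. min (c x) k"
  have d: "trans_labelling (verts G) (adjacent G) ?d" by (rule trans_labelling_cap[OF c k])
  let ?P = "\<lambda>i. {x \<in> verts G. ?d x = i}"
  have "?P i \<noteq> {}" if "i \<in> {1..k}" for i
  proof (cases "i = k")
    case True
    then show ?thesis using v by (auto simp: k_def)
  next
    case False
    then show ?thesis using d v that unfolding trans_labelling_def k_def by fastforce
  qed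
  moreover have "(\<Union>i\<in>{1..k}. ?P i) = verts G" using d by (auto simp: trans_labelling_def)
  moreover have "disjoint_family_on ?P {1..k}" by (auto simp: disjoint_family_on_def)
  moreover have "dominates G (?P i) (?P j)" if "1 \<le> i \<and> i < j \<and> j \<le> k" for i j
    using d that unfolding trans_labelling_def dominates_def by fastforce
  ultimately show "transitive_partition G (c v) ?P"
    unfolding transitive_partition_def vertex_partition_def k_def by blast
qed

lemma labelling_of_partition:
  assumes P: "transitive_partition G k P" and k: "1 \<le> k"
  shows "\<exists>c v. trans_labelling (verts G) (adjacent G) c \<and> v \<in> verts G \<and> c v = k"
proof -
  have part: "\<And>i. i \<in> {1..k} \<Longrightarrow> P i \<noteq> {}" "disjoint_family_on P {1..k}" "(\<Union>i\<in>{1..k}. P i) = verts G"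
    using P by (auto simp: transitive_partition_def vertex_partition_def)
  define c where "c = (\<lambda>x. THE i. i \<in> {1..k} \<and> x \<in> P i)"
  have c: "c x = i" if "i \<in> {1..k}" "x \<in> P i" for x i
    unfolding c_def
  proof (rule the_equality)
    show "j = i" if "j \<in> {1..k} \<and> x \<in> P j" for j
      using that \<open>i \<in> {1..k}\<close> \<open>x \<in> P i\<close> part(2) unfolding disjoint_family_on_def by blast
  qed (use that in blast)
  have "trans_labelling (verts G) (adjacent G) c"
    unfolding trans_labelling_def
  proof
    fix x assume "x \<in> verts G"
    then obtain j where j: "j \<in> {1..k}" "x \<in> P j" using part(3) by blast
    have "\<exists>y\<in>verts G. adjacent G x y \<and> c y = i" if "1 \<le> i \<and> i < j" for i
    proof -
      have i: "i \<in> {1..k}" using that j by auto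
      have "dominates G (P i) (P j)" using P that j unfolding transitive_partition_def by auto
      then obtain y where "y \<in> P i" "adjacent G x y" using j unfolding dominates_def by blast
      then show ?thesis using c[OF i] i part(3) by blast
    qed
    then show "1 \<le> c x \<and> (\<forall>i. 1 \<le> i \<and> i < c x \<longrightarrow> (\<exists>y\<in>verts G. adjacent G x y \<and> c y = i))"
      using c[OF j] j by simp
  qed
  moreover obtain v where "v \<in> P k" using part(1)[of k] k by auto
  moreover have "k \<in> {1..k}" using k by simp
  ultimately show ?thesis using c part(3) by blast
qed

text \<open>Capping makes the attained labels downward closed, so each comparison with the maximum
  becomes an existence statement. The program later counts the \<open>k\<close> that pass this
  test.\<close>

lemma transitivity_bounds:
  assumes "simple_graph G" "verts G \<noteq> {}"
  shows "transitivity G \<le> card (verts G)"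
    and "1 \<le> k \<Longrightarrow> k \<le> transitivity G \<longleftrightarrow>
      (\<exists>c v. trans_labelling (verts G) (adjacent G) c \<and> v \<in> verts G \<and> c v = k)"
proof -
  let ?K = "{k. \<exists>P. transitive_partition G k P}"
  have fin: "finite (verts G)" using assms by (simp add: simple_graph_def)
  have le: "k \<le> card (verts G)" if "k \<in> ?K" for k
    using that vertex_partition_le_card[OF _ fin] by (auto simp: transitive_partition_def)
  then have finK: "finite ?K" by (meson finite_nat_set_iff_bounded_le)
  obtain v where v: "v \<in> verts G" using assms by blast
  have "trans_labelling (verts G) (adjacent G) (\<lambda>x. 1)" by (simp add: trans_labelling_def)
  then have "1 \<in> ?K" using partition_of_labelling v by fastforce
  then have TrK: "transitivity G \<in> ?K" unfolding transitivity_def using finK by (intro Max_in) auto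
  then show "transitivity G \<le> card (verts G)" by (rule le)
  assume k: "1 \<le> k"
  show "k \<le> transitivity G \<longleftrightarrow> (\<exists>c v. trans_labelling (verts G) (adjacent G) c \<and> v \<in> verts G \<and> c v = k)"
  proof
    assume kT: "k \<le> transitivity G"
    obtain P where "transitive_partition G (transitivity G) P" using TrK by blast
    then obtain c v where c: "trans_labelling (verts G) (adjacent G) c" "v \<in> verts G" "c v = transitivity G"
      using labelling_of_partition kT k by (meson le_trans)
    then show "\<exists>c v. trans_labelling (verts G) (adjacent G) c \<and> v \<in> verts G \<and> c v = k"
      using trans_labelling_cap[OF c(1) k] kT by (intro exI[of _ "\<lambda>x. min (c x) k"] exI[of _ v]) auto
  next
    assume "\<exists>c v. trans_labelling (verts G) (adjacent G) c \<and> v \<in> verts G \<and> c v = k"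
    then obtain c v where "trans_labelling (verts G) (adjacent G) c" "v \<in> verts G" "c v = k" by blast
    then have "k \<in> ?K" using partition_of_labelling[of G c v] by simp
    then show "k \<le> transitivity G" unfolding transitivity_def using finK by (intro Max_ge)
  qed
qed

text \<open>Following successors forever inside a finite set must revisit a vertex; the stretch up
  to the first repetition is the cycle.\<close>

lemma cyclic_triple_cycle:
  fixes X :: "nat \<Rightarrow> 'a set"
  assumes succ: "\<And>n x. x \<in> X (n mod 3) \<Longrightarrow> \<exists>y\<in>X (Suc n mod 3). R x y"
    and disj: "\<And>i j. i < 3 \<Longrightarrow> j < 3 \<Longrightarrow> i \<noteq> j \<Longrightarrow> X i \<inter> X j = {}"
    and fin: "\<And>i. i < 3 \<Longrightarrow> finite (X i)" and ne: "X 0 \<noteq> {}"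
  shows "\<exists>ys. distinct ys \<and> 3 \<le> length ys \<and> (\<forall>e\<in>cycle_edges ys. \<exists>y z. e = {y, z} \<and> R y z) \<and>
    set ys \<subseteq> (\<Union>i<3. X i) \<and> (\<forall>i<3. set ys \<inter> X i \<noteq> {})"
proof -
  have "\<exists>g. \<forall>n. g n \<in> X (n mod 3) \<and> R (g n) (g (Suc n))"
  proof (rule dependent_nat_choice)
    show "\<exists>x. x \<in> X (0 mod 3)" using ne by auto
    show "\<exists>y. y \<in> X (Suc n mod 3) \<and> R x y" if "x \<in> X (n mod 3)" for x n using succ[OF that] by blast
  qed
  then obtain g where g: "\<And>n. g n \<in> X (n mod 3)" "\<And>n. R (g n) (g (Suc n))" by blast
  have gX: "range g \<subseteq> (\<Union>i<3. X i)"
  proof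
    fix x assume "x \<in> range g"
    then obtain n where "x = g n" by blast
    then show "x \<in> (\<Union>i<3. X i)" using g(1)[of n] by (intro UN_I[of "n mod 3"]) auto
  qed
  then have "finite (range g)" using fin finite_subset by (metis (no_types, lifting) finite_UN finite_lessThan lessThan_iff)
  then have "\<not> inj g" using finite_imageD infinite_UNIV_nat by blast
  then obtain i0 j0 where ij0: "i0 < j0" "g i0 = g j0" unfolding inj_def by (metis nat_neq_iff)
  define j where "j = (LEAST j. \<exists>i<j. g i = g j)"
  have "\<exists>i<j. g i = g j" unfolding j_def by (rule LeastI[of _ j0]) (use ij0 in blast)
  then obtain i where i: "i < j" "g i = g j" by blast
  have inj: "\<not> (\<exists>a<b. g a = g b)" if "b < j" for b using not_less_Least that unfolding j_def by blast
  have "g i \<in> X (i mod 3) \<inter> X (j mod 3)" using g(1)[of i] g(1)[of j] i(2) by auto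
  \<comment> \<open>The classes are passed in cyclic order, so the stretch has length a multiple of
    3. It therefore has at least three vertices and meets every class.\<close>
  then have "i mod 3 = j mod 3" using disj[of "i mod 3" "j mod 3"] by fastforce
  then have len: "i + 3 \<le> j" using i(1) by presburger
  let ?ys = "map g [i..<j]"
  have "inj_on g {i..<j}"
  proof (rule inj_onI)
    fix a b assume "a \<in> {i..<j}" "b \<in> {i..<j}" "g a = g b"
    then show "a = b" using inj[of a] inj[of b] by (metis atLeastLessThan_iff nat_neq_iff)
  qed
  then have "distinct ?ys" by (simp add: distinct_map)
  moreover have "successively R ?ys" using g(2) by (simp add: successively_conv_nth)
  moreover have "R (last ?ys) (hd ?ys)"
  proof -
    have "last ?ys = g (j - 1)" "hd ?ys = g i" using i(1) by (simp_all add: last_map hd_map)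
    then show ?thesis using g(2)[of "j - 1"] i by simp
  qed
  moreover have "set ?ys \<inter> X a \<noteq> {}" if "a < 3" for a
  proof -
    have "\<exists>n\<in>{i..<i + 3}. n mod 3 = a"
    proof -
      have "a = 0 \<or> a = 1 \<or> a = 2" using that by auto
      then have "i mod 3 = a \<or> (i + 1) mod 3 = a \<or> (i + 2) mod 3 = a" by presburger
      then show ?thesis by (metis add_less_cancel_left atLeastLessThan_iff le_add1 less_add_same_cancel1 numeral_3_eq_3 one_less_numeral_iff semiring_norm(77) zero_less_Suc lessI numeral_2_eq_2 Suc_1 order_refl)
    qed
    then obtain n where "i \<le> n" "n < j" "n mod 3 = a" using len by auto
    then have "g n \<in> set ?ys \<inter> X a" using g(1)[of n] by simp
    then show ?thesis by blast
  qed
  ultimately show ?thesis using cycle_edges_related[of R ?ys] len gX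
    by (intro exI[of _ ?ys] conjI) (auto simp del: upt_Suc)
qed

lemma Union_cycle_edges: "ys \<noteq> [] \<Longrightarrow> \<Union>(cycle_edges ys) = set ys"
proof
  assume ne: "ys \<noteq> []"
  show "\<Union>(cycle_edges ys) \<subseteq> set ys" using ne by (auto simp: cycle_edges_def)
  show "set ys \<subseteq> \<Union>(cycle_edges ys)"
  proof
    fix x assume "x \<in> set ys"
    then obtain i where "i < length ys" "x = ys ! i" by (auto simp: in_set_conv_nth)
    then show "x \<in> \<Union>(cycle_edges ys)" unfolding cycle_edges_def
      by (intro UnionI[of "{ys ! i, ys ! (Suc i mod length ys)}"]) auto
  qed
qed

text \<open>A tournament without cyclic triples is transitive, so the number of predecessors is a
  linear rank.\<close>

lemma tournament_rank:
  assumes fin: "finite J"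
    and total: "\<And>x y. x \<in> J \<Longrightarrow> y \<in> J \<Longrightarrow> x \<noteq> y \<Longrightarrow> T x y \<or> T y x"
    and asym: "\<And>x y. T x y \<Longrightarrow> \<not> T y x"
    and acyclic: "\<And>x y z. x \<in> J \<Longrightarrow> y \<in> J \<Longrightarrow> z \<in> J \<Longrightarrow> \<not> (T x y \<and> T y z \<and> T z x)"
  shows "\<exists>r. bij_betw r J {1..card J} \<and> (\<forall>x\<in>J. \<forall>y\<in>J. r x < r y \<longrightarrow> T x y)"
proof -
  define r where "r = (\<lambda>x. Suc (card {y\<in>J. T y x}))"
  have trans: "T x z" if "x \<in> J" "y \<in> J" "z \<in> J" "T x y" "T y z" for x y z
    using that total[of x z] asym acyclic by metis
  have less: "r x < r y" if "x \<in> J" "y \<in> J" "T x y" for x y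
  proof -
    have "{z\<in>J. T z x} \<subset> {z\<in>J. T z y}" using that trans asym by blast
    then have "card {z\<in>J. T z x} < card {z\<in>J. T z y}" using fin by (intro psubset_card_mono) auto
    then show ?thesis by (simp add: r_def)
  qed
  have inj: "inj_on r J"
    by (rule inj_onI) (metis less total less_irrefl)
  have "r ` J \<subseteq> {1..card J}"
  proof
    fix n assume "n \<in> r ` J"
    then obtain x where x: "x \<in> J" "n = r x" by blast
    have "{y\<in>J. T y x} \<subset> J" using x asym by blast
    then have "card {y\<in>J. T y x} < card J" using fin by (intro psubset_card_mono) auto
    then show "n \<in> {1..card J}" using x by (simp add: r_def)
  qed
  then have "r ` J = {1..card J}" using inj by (intro card_subset_eq) (auto simp: card_image)
  then have "bij_betw r J {1..card J}" using inj by (simp add: bij_betw_def)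
  moreover have "T x y" if "x \<in> J" "y \<in> J" "r x < r y" for x y
    using that less[of y x] total[of x y] by (cases "x = y") auto
  ultimately show ?thesis by blast
qed

section \<open>The domination tournament of an upper domatic partition\<close>

locale unicyclic_domatic =
  fixes G :: "'a graph" and k :: nat and P :: "nat \<Rightarrow> 'a set"
  assumes unicyclic: "unicyclic G" and partition: "upper_domatic_partition G k P"
begin

abbreviation R where "R \<equiv> adjacent G"

text \<open>Mutual domination is decided by the index, which makes the relation a tournament on the
  classes.\<close>

definition T :: "nat \<Rightarrow> nat \<Rightarrow> bool" where
  "T i j \<longleftrightarrow> i \<in> {1..k} \<and> j \<in> {1..k} \<and> i \<noteq> j \<and> dominates G (P i) (P j) \<and>
     (\<not> dominates G (P j) (P i) \<or> i < j)"

lemma R: "symp R" "irreflp R"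
  using unicyclic by (auto simp: unicyclic_def adjacent_symp adjacent_irreflp)

lemma finite_verts: "finite (verts G)"
  using unicyclic by (simp add: unicyclic_def simple_graph_def)

lemma parts: "i \<in> {1..k} \<Longrightarrow> P i \<noteq> {}" "disjoint_family_on P {1..k}" "(\<Union>i\<in>{1..k}. P i) = verts G"
  using partition by (auto simp: upper_domatic_partition_def vertex_partition_def)

lemma part_disjoint: "i \<in> {1..k} \<Longrightarrow> j \<in> {1..k} \<Longrightarrow> x \<in> P i \<Longrightarrow> x \<in> P j \<Longrightarrow> i = j"
  using parts(2) unfolding disjoint_family_on_def by blast

lemma part_subset: "i \<in> {1..k} \<Longrightarrow> P i \<subseteq> verts G"
  using parts(3) by blast

lemma T_in: "T i j \<Longrightarrow> i \<in> {1..k} \<and> j \<in> {1..k} \<and> i \<noteq> j"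
  by (simp add: T_def)

lemma T_total: "i \<in> {1..k} \<Longrightarrow> j \<in> {1..k} \<Longrightarrow> i \<noteq> j \<Longrightarrow> T i j \<or> T j i"
  using partition unfolding T_def upper_domatic_partition_def
  by (metis atLeastAtMost_iff nat_neq_iff)

lemma T_asym: "T i j \<Longrightarrow> \<not> T j i"
  by (auto simp: T_def)

lemma T_neighbour: "T i j \<Longrightarrow> x \<in> P j \<Longrightarrow> \<exists>y\<in>P i. R x y"
  by (auto simp: T_def dominates_def)

definition triangle :: "nat \<Rightarrow> nat \<Rightarrow> nat \<Rightarrow> bool" where
  "triangle i j l \<longleftrightarrow> T i j \<and> T j l \<and> T l i"

lemma triangle_rotate: "triangle i j l \<Longrightarrow> triangle j l i"
  by (auto simp: triangle_def)

text \<open>Each vertex of the triangle has a neighbour in the class dominating its own, so a walk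
  can go round forever without leaving the component of \<open>x\<close> in the induced subgraph.
  Every such component thus contains a cycle, which together with uniqueness will force
  connectedness.\<close>

lemma triangle_component_cycle:
  assumes tri: "triangle i j l" and x: "x \<in> P i"
  defines "H \<equiv> \<lambda>y z. R y z \<and> y \<in> P i \<union> P j \<union> P l \<and> z \<in> P i \<union> P j \<union> P l"
  shows "\<exists>C. is_cycle G C \<and> \<Union>C \<subseteq> {y. H\<^sup>*\<^sup>* x y} \<inter> (P i \<union> P j \<union> P l) \<and>
    \<Union>C \<inter> P i \<noteq> {} \<and> \<Union>C \<inter> P j \<noteq> {} \<and> \<Union>C \<inter> P l \<noteq> {}"
proof -
  have T: "T i j" "T j l" "T l i" using tri by (auto simp: triangle_def)
  have I: "i \<in> {1..k}" "j \<in> {1..k}" "l \<in> {1..k}" "i \<noteq> j" "j \<noteq> l" "l \<noteq> i" using T T_in by blast+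
  \<comment> \<open>The walk passes from a class to its dominator, hence against the arrows of
    \<open>T\<close>: from \<open>P i\<close> to \<open>P l\<close> to \<open>P j\<close>.\<close>
  define X where "X = (\<lambda>n::nat. {y. H\<^sup>*\<^sup>* x y} \<inter> (if n = 0 then P i else if n = 1 then P l else P j))"
  have step: "\<exists>z. z \<in> P b \<and> H\<^sup>*\<^sup>* x z \<and> R y z"
    if y: "y \<in> P a" "H\<^sup>*\<^sup>* x y" "T b a" "a \<in> {i, j, l}" "b \<in> {i, j, l}" for a b y
  proof -
    obtain z where z: "z \<in> P b" "R y z" using T_neighbour[OF y(3,1)] by blast
    then have "H y z" using y by (auto simp: H_def)
    then show ?thesis using z y(2) by (meson rtranclp.rtrancl_into_rtrancl)
  qed
  have "\<exists>ys. distinct ys \<and> 3 \<le> length ys \<and> (\<forall>e\<in>cycle_edges ys. \<exists>y z. e = {y, z} \<and> R y z) \<and>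
    set ys \<subseteq> (\<Union>i<3. X i) \<and> (\<forall>i<3. set ys \<inter> X i \<noteq> {})"
  proof (rule cyclic_triple_cycle)
    show "X 0 \<noteq> {}" using x by (auto simp: X_def)
    show "finite (X n)" if "n < 3" for n
      using I part_subset finite_verts finite_subset unfolding X_def by (metis (full_types) finite_Int)
    show "X a \<inter> X b = {}" if "a < 3" "b < 3" "a \<noteq> b" for a b
    proof -
      have "P i \<inter> P j = {}" "P j \<inter> P l = {}" "P l \<inter> P i = {}" using I part_disjoint by blast+
      then show ?thesis using that unfolding X_def by (auto split: if_splits)
    qed
    fix n y assume y: "y \<in> X (n mod 3)"
    have "n mod 3 = 0 \<or> n mod 3 = 1 \<or> n mod 3 = 2" by auto
    then consider "n mod 3 = 0" "Suc n mod 3 = 1" | "n mod 3 = 1" "Suc n mod 3 = 2" | "n mod 3 = 2" "Suc n mod 3 = 0"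
      by (auto simp: mod_Suc)
    then show "\<exists>z\<in>X (Suc n mod 3). R y z"
    proof cases
      case 1
      then show ?thesis using y step[of y i l] T by (auto simp: X_def)
    next
      case 2
      then show ?thesis using y step[of y l j] T by (auto simp: X_def)
    next
      case 3
      then show ?thesis using y step[of y j i] T by (auto simp: X_def)
    qed
  qed
  then obtain ys where ys: "distinct ys" "3 \<le> length ys" "\<forall>e\<in>cycle_edges ys. \<exists>y z. e = {y, z} \<and> R y z"
    "set ys \<subseteq> (\<Union>i<3. X i)" "\<And>i. i < 3 \<Longrightarrow> set ys \<inter> X i \<noteq> {}" by blast
  have "is_cycle G (cycle_edges ys)"
    unfolding is_cycle_cycle_edges using ys(1-3) by (auto simp: adjacent_def)
  moreover have "\<Union>(cycle_edges ys) = set ys" using ys(2) by (intro Union_cycle_edges) auto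
  moreover have "set ys \<subseteq> {y. H\<^sup>*\<^sup>* x y} \<inter> (P i \<union> P j \<union> P l)"
    using ys(4) unfolding X_def by (auto split: if_splits)
  moreover have "set ys \<inter> P i \<noteq> {}" "set ys \<inter> P l \<noteq> {}" "set ys \<inter> P j \<noteq> {}"
    using ys(5)[of 0] ys(5)[of 1] ys(5)[of 2] by (auto simp: X_def)
  ultimately show ?thesis by (intro exI[of _ "cycle_edges ys"]) simp
qed

lemma triangle_cycle:
  assumes "triangle i j l"
  shows "\<exists>C. is_cycle G C \<and> \<Union>C \<subseteq> P i \<union> P j \<union> P l \<and>
    \<Union>C \<inter> P i \<noteq> {} \<and> \<Union>C \<inter> P j \<noteq> {} \<and> \<Union>C \<inter> P l \<noteq> {}"
proof -
  have "i \<in> {1..k}" using assms T_in by (auto simp: triangle_def)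
  then obtain x where "x \<in> P i" using parts(1) by blast
  from triangle_component_cycle[OF assms this] show ?thesis
    by (elim exE conjE, intro exI conjI) (assumption | erule order.trans | rule Int_lower2)+
qed

lemma cycle_unique: "is_cycle G C \<Longrightarrow> is_cycle G C' \<Longrightarrow> C = C'"
  using unicyclic by (auto simp: unicyclic_def)

text \<open>The classes of a triangle are recovered from the unique cycle as those that it
  meets.\<close>

lemma triangle_unique:
  assumes "triangle i j l" "triangle i' j' l'"
  shows "{i, j, l} = {i', j', l'}"
proof -
  have *: "{i, j, l} = {m \<in> {1..k}. P m \<inter> \<Union>C \<noteq> {}}"
    if tri: "triangle i j l" and C: "is_cycle G C" for i j l C
  proof -
    have I: "i \<in> {1..k}" "j \<in> {1..k}" "l \<in> {1..k}" using tri T_in by (auto simp: triangle_def)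
    obtain C' where C': "is_cycle G C'" "\<Union>C' \<subseteq> P i \<union> P j \<union> P l"
       "\<Union>C' \<inter> P i \<noteq> {}" "\<Union>C' \<inter> P j \<noteq> {}" "\<Union>C' \<inter> P l \<noteq> {}"
      using triangle_cycle[OF tri] by blast
    have eq: "C' = C" using cycle_unique C C' by blast
    show ?thesis
    proof
      show "{i, j, l} \<subseteq> {m \<in> {1..k}. P m \<inter> \<Union>C \<noteq> {}}" using C' I unfolding eq by auto
      show "{m \<in> {1..k}. P m \<inter> \<Union>C \<noteq> {}} \<subseteq> {i, j, l}"
        using C'(2) I part_disjoint unfolding eq by blast
    qed
  qed
  obtain C where C: "is_cycle G C" using unicyclic by (auto simp: unicyclic_def)
  show ?thesis by (rule trans[OF *[OF assms(1) C] *[OF assms(2) C, symmetric]])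
qed

text \<open>The components of \<open>x\<close> and of \<open>y\<close> both contain the unique
  cycle, so they coincide.\<close>

lemma triangle_connected:
  assumes tri: "triangle i j l" and "x \<in> P i" "y \<in> P j"
  defines "H \<equiv> \<lambda>y z. R y z \<and> y \<in> P i \<union> P j \<union> P l \<and> z \<in> P i \<union> P j \<union> P l"
  shows "H\<^sup>*\<^sup>* x y"
proof -
  obtain C where C: "is_cycle G C" "\<Union>C \<subseteq> {z. H\<^sup>*\<^sup>* x z} \<inter> (P i \<union> P j \<union> P l)" "\<Union>C \<inter> P i \<noteq> {}"
    using triangle_component_cycle[OF tri assms(2), folded H_def] by metis
  have H': "(\<lambda>y z. R y z \<and> y \<in> P j \<union> P l \<union> P i \<and> z \<in> P j \<union> P l \<union> P i) = H"
    unfolding H_def by (intro ext) auto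
  obtain C' where C': "is_cycle G C'" "\<Union>C' \<subseteq> {z. H\<^sup>*\<^sup>* y z} \<inter> (P j \<union> P l \<union> P i)"
    using triangle_component_cycle[OF triangle_rotate[OF tri] assms(3), unfolded H'] by metis
  have "C = C'" using cycle_unique C C' by blast
  moreover obtain z where z: "z \<in> \<Union>C" using C(3) by (meson Int_emptyI)
  ultimately have "H\<^sup>*\<^sup>* x z" "H\<^sup>*\<^sup>* y z" using subsetD[OF C(2) z] subsetD[OF C'(2)] by simp_all
  moreover have "symp H" using R(1) by (auto simp: H_def symp_def)
  ultimately show ?thesis using rtranclp_symp by (meson rtranclp_trans)
qed

text \<open>A vertex of \<open>P d\<close> would have neighbours in two classes of the triangle.
  These are connected inside the triangle, so a cycle would pass through \<open>P d\<close>, whereas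
  the unique cycle stays in the triangle.\<close>

lemma no_common_successor:
  assumes tri: "triangle i j l" and d: "d \<notin> {i, j, l}"
  shows "\<not> (T i d \<and> T j d)"
proof
  assume Td: "T i d \<and> T j d"
  have I: "i \<in> {1..k}" "j \<in> {1..k}" "l \<in> {1..k}" "i \<noteq> j" "d \<in> {1..k}"
    using tri T_in Td by (auto simp: triangle_def)
  let ?W = "P i \<union> P j \<union> P l"
  obtain v where v: "v \<in> P d" using parts(1) I by blast
  then obtain x y where xy: "x \<in> P i" "y \<in> P j" "R v x" "R v y" using T_neighbour Td by blast
  have vW: "v \<notin> ?W" using v I d part_disjoint by blast
  have "(\<lambda>y z. R y z \<and> y \<in> ?W \<and> z \<in> ?W)\<^sup>*\<^sup>* x y" by (rule triangle_connected[OF tri xy(1,2)])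
  then have "reach_avoiding R v x y"
    unfolding reach_avoiding_def by (rule rtranclp_mono[THEN predicate2D, rotated]) (use vW in auto)
  moreover have "x \<noteq> y" using xy part_disjoint I by blast
  ultimately have "cycle_edge R v y" using xy unfolding cycle_edge_def by blast
  then obtain C where C: "is_cycle G C" "{v, y} \<in> C" using subgraph_cycle[OF R, of v y G] by blast
  obtain C' where C': "is_cycle G C'" "\<Union>C' \<subseteq> ?W" using triangle_cycle[OF tri] by blast
  have "C = C'" using cycle_unique C C' by blast
  then show False using C C' vW by blast
qed

text \<open>If \<open>T i d\<close> held, then \<open>T l d\<close> is excluded as a common
  successor, so \<open>T d l\<close>, and \<open>i\<close>, \<open>d\<close>, \<open>l\<close> would
  form a second triangle.\<close>

lemma triangle_dominated_aux:
  assumes tri: "triangle i j l" and d: "d \<in> {1..k}" "d \<notin> {i, j, l}"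
  shows "T d i"
proof (rule ccontr)
  assume not: "\<not> T d i"
  have T: "T i j" "T j l" "T l i" using tri by (auto simp: triangle_def)
  have I: "i \<in> {1..k}" "j \<in> {1..k}" "l \<in> {1..k}" using T T_in by blast+
  have id: "T i d" using T_total[of d i] not d I by blast
  then have "\<not> T l d" using no_common_successor[of l i j d] triangle_rotate[OF triangle_rotate[OF tri]] d by auto
  then have "T d l" using T_total[of d l] d I by blast
  then have "triangle i d l" using id T by (simp add: triangle_def)
  then have "{i, d, l} = {i, j, l}" using tri by (rule triangle_unique)
  then show False using d by blast
qed

lemma triangle_dominated:
  assumes "triangle i j l" "d \<in> {1..k}" "d \<notin> {i, j, l}"
  shows "T d i" "T d j" "T d l"
  using triangle_dominated_aux[OF assms] triangle_dominated_aux[OF triangle_rotate[OF assms(1)]]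
    triangle_dominated_aux[OF triangle_rotate[OF triangle_rotate[OF assms(1)]]] assms by auto

definition part_of :: "'a \<Rightarrow> nat" where
  "part_of x = (THE i. i \<in> {1..k} \<and> x \<in> P i)"

lemma part_of: "i \<in> {1..k} \<Longrightarrow> x \<in> P i \<Longrightarrow> part_of x = i"
  unfolding part_of_def by (rule the_equality) (use part_disjoint in blast)+

lemma labelling_acyclic:
  assumes k: "1 \<le> k" and no: "\<And>i j l. \<not> triangle i j l"
  shows "\<exists>c v. trans_labelling (verts G) R c \<and> v \<in> verts G \<and> c v = k"
proof -
  have "\<exists>r. bij_betw r {1..k} {1..card {1..k}} \<and> (\<forall>x\<in>{1..k}. \<forall>y\<in>{1..k}. r x < r y \<longrightarrow> T x y)"
  proof (rule tournament_rank)
    show "\<not> (T x y \<and> T y z \<and> T z x)" for x y z using no[of x y z] by (simp add: triangle_def)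
  qed (simp, rule T_total, assumption+, rule T_asym)
  then obtain r where r: "bij_betw r {1..k} {1..k}" "\<And>x y. x \<in> {1..k} \<Longrightarrow> y \<in> {1..k} \<Longrightarrow> r x < r y \<Longrightarrow> T x y"
    by auto
  have im: "r ` {1..k} = {1..k}" using r(1) by (rule bij_betw_imp_surj_on)
  have surj: "\<exists>i\<in>{1..k}. r i = n" if "n \<in> {1..k}" for n
  proof -
    have "n \<in> r ` {1..k}" using that unfolding im .
    then show ?thesis by (rule imageE) blast
  qed
  have rI: "r i \<in> {1..k}" if "i \<in> {1..k}" for i using imageI[OF that, of r] unfolding im .
  have "trans_labelling (verts G) R (\<lambda>x. r (part_of x))"
    unfolding trans_labelling_def
  proof
    fix x assume "x \<in> verts G"
    then obtain j where j: "j \<in> {1..k}" "x \<in> P j" using parts(3) by blast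
    have "\<exists>y\<in>verts G. R x y \<and> r (part_of y) = n" if "1 \<le> n \<and> n < r j" for n
    proof -
      have "n \<in> {1..k}" using that rI[OF j(1)] by auto
      then obtain i where i: "i \<in> {1..k}" "r i = n" using surj by blast
      then have "T i j" using r(2) j that by blast
      then obtain y where "y \<in> P i" "R x y" using T_neighbour j by blast
      then show ?thesis using part_of i part_subset by blast
    qed
    then show "1 \<le> r (part_of x) \<and> (\<forall>i. 1 \<le> i \<and> i < r (part_of x) \<longrightarrow> (\<exists>y\<in>verts G. R x y \<and> r (part_of y) = i))"
      using part_of[OF j] rI[OF j(1)] by simp
  qed
  moreover obtain i where i: "i \<in> {1..k}" "r i = k" using surj[of k] k by auto
  moreover obtain v where "v \<in> P i" using parts(1) i by blast
  ultimately show ?thesis using part_of[of i v] part_subset[of i]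
    by (intro exI[of _ "\<lambda>x. r (part_of x)"] exI[of _ v]) auto
qed

text \<open>The classes of the triangle \<open>A \<rightarrow> B \<rightarrow> C \<rightarrow> A\<close> come last, and a vertex \<open>z\<close> of \<open>C\<close> that dominates
  a vertex of \<open>A\<close> also has a neighbour \<open>y\<close> in \<open>B\<close>.  So \<open>A\<close>, \<open>{y}\<close>, \<open>{z}\<close> can serve as the last three
  classes, and the rest of \<open>B\<close> and \<open>C\<close> is moved to the first class.\<close>

lemma labelling_triangle:
  assumes tri: "triangle i j l"
  shows "\<exists>c v. trans_labelling (verts G) R c \<and> v \<in> verts G \<and> c v = k"
proof -
  have T: "T i j" "T j l" "T l i" using tri by (auto simp: triangle_def)
  have I: "i \<in> {1..k}" "j \<in> {1..k}" "l \<in> {1..k}" "i \<noteq> j" "j \<noteq> l" "l \<noteq> i" using T T_in by blast+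
  define J where "J = {1..k} - {i, j, l}"
  have k: "k = card J + 3"
  proof -
    have "card {i, j, l} = 3" using I by auto
    moreover have "card {i, j, l} \<le> k" using I card_mono[of "{1..k}" "{i, j, l}"] by auto
    ultimately show ?thesis using I by (simp add: J_def card_Diff_subset)
  qed
  have "\<exists>r. bij_betw r J {1..card J} \<and> (\<forall>x\<in>J. \<forall>y\<in>J. r x < r y \<longrightarrow> T x y)"
  proof (rule tournament_rank)
    fix x y z assume xyz: "x \<in> J" "y \<in> J" "z \<in> J"
    \<comment> \<open>Any triangle has the classes \<open>{i, j, l}\<close>, none of which is in
      \<open>J\<close>.\<close>
    show "\<not> (T x y \<and> T y z \<and> T z x)"
      using triangle_unique[OF tri, of x y z] xyz by (auto simp: triangle_def J_def)
  next
    show "T x y \<or> T y x" if "x \<in> J" "y \<in> J" "x \<noteq> y" for x y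
      using that unfolding J_def by (intro T_total) blast+
    show "finite J" by (simp add: J_def)
  qed (rule T_asym)
  then obtain r where r: "bij_betw r J {1..card J}" "\<And>x y. x \<in> J \<Longrightarrow> y \<in> J \<Longrightarrow> r x < r y \<Longrightarrow> T x y" by blast
  have im: "r ` J = {1..card J}" using r(1) by (rule bij_betw_imp_surj_on)
  have surj: "\<exists>m\<in>J. r m = n" if "n \<in> {1..card J}" for n
  proof -
    have "n \<in> r ` J" using that unfolding im .
    then show ?thesis by (rule imageE) blast
  qed
  have rJ: "r m \<in> {1..card J}" if "m \<in> J" for m using imageI[OF that, of r] unfolding im .
  obtain a where a: "a \<in> P i" using parts(1) I by blast
  obtain z where z: "z \<in> P l" "R a z" using T_neighbour[OF T(3) a] by blast
  obtain y where y: "y \<in> P j" "R z y" using T_neighbour[OF T(2) z(1)] by blast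
  \<comment> \<open>This neighbour of \<open>y\<close> need not be the neighbour \<open>a\<close> of
    \<open>z\<close>, so all of \<open>P i\<close> will receive the label
    \<open>k - 2\<close>.\<close>
  obtain a' where a': "a' \<in> P i" "R y a'" using T_neighbour[OF T(1) y(1)] by blast
  have za: "R z a" using z(2) R(1) by (auto dest: sympD)
  define c where "c = (\<lambda>x. if x = z then k else if x = y then k - 1 else if part_of x = i then k - 2
     else if part_of x \<in> {j, l} then 1 else r (part_of x))"
  have cz: "c z = k" by (simp add: c_def)
  have "y \<noteq> z" using y z I part_disjoint by blast
  then have cy: "c y = k - 1" by (simp add: c_def)
  have ci: "c x = k - 2" if "x \<in> P i" for x
    using that part_of[OF I(1)] part_disjoint[OF I(1,2)] part_disjoint[OF I(1,3)] y z I by (auto simp: c_def)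
  have cJ: "c x = r m" if "m \<in> J" "x \<in> P m" for x m
  proof -
    have "m \<in> {1..k}" "m \<notin> {i, j, l}" using that by (auto simp: J_def)
    then show ?thesis using part_of[of m x] that part_disjoint[of m j] part_disjoint[of m l] y z I by (auto simp: c_def)
  qed
  \<comment> \<open>Classes in \<open>J\<close> dominate the whole triangle, so the labels up to
    \<open>card J\<close>, that is \<open>k - 3\<close>, are supplied to it as well as to the later
    classes of \<open>J\<close>.\<close>
  have low: "\<exists>w\<in>verts G. R x w \<and> c w = n" if lo: "x \<in> P m" "n \<in> {1..card J}" "m \<in> {i, j, l} \<or> m \<in> J \<and> n < r m" for x m n
  proof -
    obtain m' where m': "m' \<in> J" "r m' = n" using surj[OF lo(2)] by blast
    then have mk: "m' \<in> {1..k}" "m' \<notin> {i, j, l}" by (auto simp: J_def)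
    then have "T m' m" using lo(3) r(2)[OF m'(1)] m'(2) triangle_dominated[OF tri mk] by auto
    then obtain w where "w \<in> P m'" "R x w" using T_neighbour[OF _ lo(1)] by blast
    then show ?thesis using cJ m' part_subset[OF mk(1)] by blast
  qed
  have top: "\<exists>w\<in>verts G. R x w \<and> c w = n" if "1 \<le> n" "n < c x" "m \<in> {i, j, l}" "x \<in> P m" "c x \<le> k - 2" for x m n
    using low[of x m n] that k by auto
  have "trans_labelling (verts G) R c"
    unfolding trans_labelling_def
  proof (intro ballI conjI allI impI)
    fix x assume "x \<in> verts G"
    then obtain m where m: "m \<in> {1..k}" "x \<in> P m" using parts(3) by blast
    show "1 \<le> c x"
    proof (cases "m \<in> J")
      case True
      then show ?thesis using cJ rJ m by fastforce
    next
      case False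
      then have "part_of x \<in> {i, j, l}" using part_of[OF m] m by (auto simp: J_def)
      then show ?thesis using k by (auto simp: c_def)
    qed
    fix n assume n: "1 \<le> n \<and> n < c x"
    consider "m \<in> J" | "m \<in> {i, j, l}" "x = z" | "m \<in> {i, j, l}" "x = y" | "m \<in> {i, j, l}" "x \<noteq> y" "x \<noteq> z"
      using m by (auto simp: J_def)
    then show "\<exists>w\<in>verts G. R x w \<and> c w = n"
    proof cases
      case 1
      then show ?thesis using low[of x m n] m n cJ[OF 1 m(2)] rJ[OF 1] by auto
    next
      case 2
      consider "n \<in> {1..card J}" | "n = k - 2" | "n = k - 1" using n 2 cz k by fastforce
      then show ?thesis
      proof cases
        case 1
        then show ?thesis using low[of x m n] m 2 by blast
      next
        case _: 2
        then show ?thesis using za ci[OF a] 2 a part_subset[OF I(1)] by blast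
      next
        case 3
        then show ?thesis using y cy 2 part_subset[OF I(2)] by blast
      qed
    next
      case 3
      consider "n \<in> {1..card J}" | "n = k - 2" using n 3 cy k by fastforce
      then show ?thesis
      proof cases
        case 1
        then show ?thesis using low[of x m n] m 3 by blast
      next
        case 2
        then show ?thesis using a' ci[OF a'(1)] 3 part_subset[OF I(1)] by blast
      qed
    next
      case 4
      then have "c x \<le> k - 2" using part_of[OF m] k by (auto simp: c_def)
      then show ?thesis using top[of n x m] n 4 m by blast
    qed
  qed
  then show ?thesis using cz z part_subset[OF I(3)] by blast
qed

lemma transitive_partition_exists: "\<exists>P'. transitive_partition G k P'"
proof (cases "k = 0")
  case True
  then show ?thesis using partition unfolding upper_domatic_partition_def transitive_partition_def by auto
next
  case False
  then have "\<exists>c v. trans_labelling (verts G) R c \<and> v \<in> verts G \<and> c v = k"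
    using labelling_acyclic labelling_triangle by (metis One_nat_def Suc_leI neq0_conv)
  then obtain c v where "trans_labelling (verts G) R c" "v \<in> verts G" "c v = k" by blast
  then show ?thesis using partition_of_labelling[of G c v] by simp
qed

end

lemma upper_domatic_number_eq:
  assumes "unicyclic G"
  shows "upper_domatic_number G = transitivity G"
proof -
  have "(\<exists>P. upper_domatic_partition G k P) \<longleftrightarrow> (\<exists>P. transitive_partition G k P)" for k
    using unicyclic_domatic.transitive_partition_exists[OF unicyclic_domatic.intro[OF assms]]
    unfolding upper_domatic_partition_def transitive_partition_def by blast
  then show ?thesis by (simp add: upper_domatic_number_def transitivity_def)
qed

section \<open>Compiling bounded sums and tables\<close>

text \<open>Sums run only over indices below \<open>n\<close>, so a fixed expression takes
  polynomially many steps. A sum is an existential quantifier when tested for being nonzero, a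
  universal one when its terms are violations and it is tested for zero, and a count when its terms
  are 0 or 1.\<close>

datatype bexpr =
    Pure expr
  | Add bexpr bexpr
  | Sub bexpr bexpr
  | Cond bexpr bexpr bexpr
  | Sum nat bexpr

fun beval :: "memory \<Rightarrow> bexpr \<Rightarrow> nat" where
  "beval m (Pure e) = eval_expr m e"
| "beval m (Add a b) = beval m a + beval m b"
| "beval m (Sub a b) = beval m a - beval m b"
| "beval m (Cond c a b) = (if beval m c \<noteq> 0 then beval m a else beval m b)"
| "beval m (Sum k b) = (\<Sum>i<m (''n'', []). beval (m((''v'', [k]) := i)) b)"

abbreviation lv :: "nat \<Rightarrow> expr" where "lv j \<equiv> Cell ''v'' [Const j]"
abbreviation tv :: "nat \<Rightarrow> expr" where "tv d \<equiv> Cell ''t'' [Const d]"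

text \<open>Loop variables are the cells of the array \<open>''v''\<close>, indexed by nesting depth, and \<open>''t''\<close> holds
  intermediate results.  The table \<open>A\<close> under construction may be read only in the row given by the
  outermost loop variable, so writing to later rows does not affect earlier ones.\<close>

fun wf_expr :: "string \<Rightarrow> nat \<Rightarrow> expr \<Rightarrow> bool" where
  "wf_expr A k (Const c) = True"
| "wf_expr A k (Cell x es) = (x \<noteq> ''t'' \<and> (x = ''v'' \<longrightarrow> (\<exists>j<k. es = [Const j])) \<and>
     (x = A \<longrightarrow> 0 < k \<and> (\<exists>es'. es = lv 0 # es')) \<and> (\<forall>e\<in>set es. wf_expr A k e))"
| "wf_expr A k (Plus a b) = (wf_expr A k a \<and> wf_expr A k b)"
| "wf_expr A k (Minus a b) = (wf_expr A k a \<and> wf_expr A k b)"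

fun wf_bexpr :: "string \<Rightarrow> nat \<Rightarrow> bexpr \<Rightarrow> bool" where
  "wf_bexpr A k (Pure e) = wf_expr A k e"
| "wf_bexpr A k (Add a b) = (wf_bexpr A k a \<and> wf_bexpr A k b)"
| "wf_bexpr A k (Sub a b) = (wf_bexpr A k a \<and> wf_bexpr A k b)"
| "wf_bexpr A k (Cond c a b) = (wf_bexpr A k c \<and> wf_bexpr A k a \<and> wf_bexpr A k b)"
| "wf_bexpr A k (Sum j b) = (j = k \<and> wf_bexpr A (Suc k) b)"

definition frame :: "string set \<Rightarrow> memory \<Rightarrow> memory \<Rightarrow> bool" where
  "frame X m m' \<longleftrightarrow> (\<forall>x is. x \<notin> X \<longrightarrow> m' (x, is) = m (x, is))"

lemma frameD: "frame X m m' \<Longrightarrow> x \<notin> X \<Longrightarrow> m' (x, ix) = m (x, ix)"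
  by (simp add: frame_def)

definition same_loop_vars :: "nat \<Rightarrow> memory \<Rightarrow> memory \<Rightarrow> bool" where
  "same_loop_vars k m m' \<longleftrightarrow> (\<forall>j<k. m' (''v'', [j]) = m (''v'', [j]))"

definition same_row :: "string \<Rightarrow> nat \<Rightarrow> memory \<Rightarrow> memory \<Rightarrow> bool" where
  "same_row A t m m' \<longleftrightarrow> (\<forall>is. m' (A, t # is) = m (A, t # is))"

lemma eval_expr_cong:
  assumes "frame {''v'', ''t'', A} m m'" "same_loop_vars k m m'" "0 < k \<Longrightarrow> same_row A (m (''v'', [0])) m m'"
  shows "wf_expr A k e \<Longrightarrow> eval_expr m' e = eval_expr m e"
proof (induction e)
  case (Cell x es)
  have args: "map (eval_expr m') es = map (eval_expr m) es"
    using Cell by auto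
  show ?case
  proof (cases "x = ''v''")
    case True
    then obtain j where "j < k" "es = [Const j]" using Cell.prems by auto
    then show ?thesis using assms(2) True by (simp add: same_loop_vars_def)
  next
    case v: False
    show ?thesis
    proof (cases "x = A")
      case True
      then obtain es' where "es = lv 0 # es'" "0 < k" using Cell.prems by auto
      then have row: "map (eval_expr m) es = m (''v'', [0]) # map (eval_expr m) es'" by simp
      have "eval_expr m' (Cell x es) = m' (A, map (eval_expr m) es)"
        unfolding eval_expr.simps args True ..
      also have "\<dots> = m (A, map (eval_expr m) es)"
        unfolding row using assms(3) \<open>0 < k\<close> by (simp only: same_row_def)
      finally show ?thesis unfolding True by simp
    next
      case False
      then have "x \<notin> {''v'', ''t'', A}" using v Cell.prems by simp
      then show ?thesis unfolding eval_expr.simps args by (rule frameD[OF assms(1)])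
    qed
  qed
qed auto

text \<open>Below a loop only the row named by the outermost variable matters. For
  \<open>k = 0\<close> that variable is not fixed yet and may take any value inside a sum, so
  agreement is asked for every row.\<close>

lemma beval_cong:
  assumes "wf_bexpr A k b" "A \<notin> {''v'', ''t'', ''n''}"
    "frame {''v'', ''t'', A} m m'" "same_loop_vars k m m'"
    "\<And>t. 0 < k \<longrightarrow> t = m (''v'', [0]) \<Longrightarrow> same_row A t m m'"
  shows "beval m' b = beval m b"
  using assms
proof (induction b arbitrary: k m m')
  case (Pure e)
  then show ?case using eval_expr_cong[of A m m' k e] by simp
next
  case (Sum j b)
  have n: "m' (''n'', []) = m (''n'', [])" using Sum.prems(2) by (intro frameD[OF Sum.prems(3)]) auto
  have "beval (m'((''v'', [k]) := i)) b = beval (m((''v'', [k]) := i)) b" for i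
  proof (rule Sum.IH[of "Suc k"])
    fix t assume t: "0 < Suc k \<longrightarrow> t = (m((''v'', [k]) := i)) (''v'', [0])"
    have "0 < k \<longrightarrow> t = m (''v'', [0])" using t by auto
    then have "same_row A t m m'" using Sum.prems(5) by blast
    then show "same_row A t (m((''v'', [k]) := i)) (m'((''v'', [k]) := i))" 
      using Sum.prems(2) by (auto simp: same_row_def)
  next
    show "wf_bexpr A (Suc k) b" using Sum.prems(1) by simp
    show "A \<notin> {''v'', ''t'', ''n''}" by (rule Sum.prems(2))
    show "frame {''v'', ''t'', A} (m((''v'', [k]) := i)) (m'((''v'', [k]) := i))"
      using Sum.prems(3) by (simp add: frame_def)
    show "same_loop_vars (Suc k) (m((''v'', [k]) := i)) (m'((''v'', [k]) := i))"
      using Sum.prems(4) by (simp add: same_loop_vars_def less_Suc_eq)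
  qed
  then show ?case using n Sum.prems(1) by simp
next
  case (Cond c a b)
  have "beval m' c = beval m c" "beval m' a = beval m a" "beval m' b = beval m b"
    using Cond.prems by (auto intro!: Cond.IH[of k])
  then show ?case by simp
next
  case (Add a b)
  have "beval m' a = beval m a" "beval m' b = beval m b"
    using Add.prems by (auto intro!: Add.IH[of k])
  then show ?case by simp
next
  case (Sub a b)
  have "beval m' a = beval m a" "beval m' b = beval m b"
    using Sub.prems by (auto intro!: Sub.IH[of k])
  then show ?case by simp
qed

section \<open>Loops and compiled expressions\<close>

lemma exec_AssignI:
  "is = map (eval_expr m) es \<Longrightarrow> x = eval_expr m e \<Longrightarrow> exec (Assign A es e) m 1 (m((A, is) := x))"
  using exec.Assign by simp

definition loop :: "nat \<Rightarrow> prog \<Rightarrow> prog" where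
  "loop k c = Seq (Assign ''v'' [Const k] (Const 0))
     (While (Minus (Cell ''n'' []) (lv k)) (Seq c (Assign ''v'' [Const k] (Plus (lv k) (Const 1)))))"

text \<open>The invariant is stated after the counter has been set. Each round pays two extra steps,
  test and increment; the final 2 are the initialization and the failing test.\<close>

lemma loop_rule:
  assumes body: "\<And>i m. i < N \<Longrightarrow> P i m \<Longrightarrow> m (''n'', []) = N \<Longrightarrow> m (''v'', [k]) = i \<Longrightarrow>
      \<exists>t m'. exec c m t m' \<and> t \<le> T \<and> P (Suc i) (m'((''v'', [k]) := Suc i)) \<and>
        m' (''n'', []) = N \<and> m' (''v'', [k]) = i"
    and init: "P 0 (m((''v'', [k]) := 0))" "m (''n'', []) = N"
  shows "\<exists>t m'. exec (loop k c) m t m' \<and> t \<le> N * (T + 2) + 2 \<and> P N m' \<and> m' (''n'', []) = N"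
proof -
  let ?w = "While (Minus (Cell ''n'' []) (lv k)) (Seq c (Assign ''v'' [Const k] (Plus (lv k) (Const 1))))"
  have while: "\<exists>t m'. exec ?w m t m' \<and> t \<le> (N - i) * (T + 2) + 1 \<and> P N m' \<and> m' (''n'', []) = N"
    if "i \<le> N" "P i m" "m (''n'', []) = N" "m (''v'', [k]) = i" for i m
    using that
  proof (induction "N - i" arbitrary: i m)
    case 0
    then have "i = N" by simp
    moreover have "exec ?w m 1 m" using 0 by (intro exec.WhileFalse) auto
    ultimately show ?case using 0 by (intro exI[of _ 1] exI[of _ m]) auto
  next
    case (Suc d)
    then have i: "i < N" by simp
    obtain t m' where m': "exec c m t m'" "t \<le> T" "P (Suc i) (m'((''v'', [k]) := Suc i))"
        "m' (''n'', []) = N" "m' (''v'', [k]) = i"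
      using body[OF i Suc.prems(2-4)] by blast
    let ?m = "m'((''v'', [k]) := Suc i)"
    have "\<exists>t2 m2. exec ?w ?m t2 m2 \<and> t2 \<le> (N - Suc i) * (T + 2) + 1 \<and> P N m2 \<and> m2 (''n'', []) = N"
      using Suc.hyps(2) i m' by (intro Suc.hyps(1)) auto
    then obtain t2 m2 where m2: "exec ?w ?m t2 m2" "t2 \<le> (N - Suc i) * (T + 2) + 1" "P N m2" "m2 (''n'', []) = N"
      by blast
    have "exec (Assign ''v'' [Const k] (Plus (lv k) (Const 1))) m' 1 ?m"
      using m' by (intro exec_AssignI) auto
    then have "exec (Seq c (Assign ''v'' [Const k] (Plus (lv k) (Const 1)))) m (t + 1) ?m"
      by (rule exec.Seq[OF m'(1)])
    then have "exec ?w m (t + 1 + t2 + 1) m2"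
      using i Suc.prems m2(1) by (intro exec.WhileTrue) auto
    moreover have "N - i = Suc (N - Suc i)" using i by simp
    then have "t + 1 + t2 + 1 \<le> (N - i) * (T + 2) + 1" using m2(2) m'(2) by simp
    ultimately show ?case using m2 by blast
  qed
  obtain t m' where m': "exec ?w (m((''v'', [k]) := 0)) t m'" "t \<le> N * (T + 2) + 1" "P N m'" "m' (''n'', []) = N"
    using while[of 0 "m((''v'', [k]) := 0)"] init by auto
  have "exec (Assign ''v'' [Const k] (Const 0)) m 1 (m((''v'', [k]) := 0))"
    by (intro exec_AssignI) auto
  then have "exec (loop k c) m (1 + t) m'" using m'(1) unfolding loop_def by (rule exec.Seq)
  moreover have "1 + t \<le> N * (T + 2) + 2" using m'(2) by simp
  ultimately show ?thesis using m'(3,4) by blast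
qed

text \<open>The cells of \<open>''t''\<close> below \<open>d\<close> act as a stack of pending
  operands; the result is left in cell \<open>d\<close>.\<close>

fun compile :: "nat \<Rightarrow> bexpr \<Rightarrow> prog" where
  "compile d (Pure e) = Assign ''t'' [Const d] e"
| "compile d (Add a b) = Seq (compile d a) (Seq (compile (Suc d) b)
     (Assign ''t'' [Const d] (Plus (tv d) (tv (Suc d)))))"
| "compile d (Sub a b) = Seq (compile d a) (Seq (compile (Suc d) b)
     (Assign ''t'' [Const d] (Minus (tv d) (tv (Suc d)))))"
| "compile d (Cond c a b) = Seq (compile d c) (If (tv d) (compile d a) (compile d b))"
| "compile d (Sum k b) = Seq (Assign ''t'' [Const d] (Const 0))
     (loop k (Seq (compile (Suc d) b) (Assign ''t'' [Const d] (Plus (tv d) (tv (Suc d))))))"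

text \<open>An upper bound that charges both branches of a conditional. In a sum each round adds
  accumulation, increment and test; the final 3 are two initializations and the failing
  test.\<close>

fun cost :: "nat \<Rightarrow> bexpr \<Rightarrow> nat" where
  "cost N (Pure e) = 1"
| "cost N (Add a b) = cost N a + cost N b + 1"
| "cost N (Sub a b) = cost N a + cost N b + 1"
| "cost N (Cond c a b) = cost N c + cost N a + cost N b + 1"
| "cost N (Sum k b) = N * (cost N b + 3) + 3"

definition same_temps :: "nat \<Rightarrow> memory \<Rightarrow> memory \<Rightarrow> bool" where
  "same_temps d m m' \<longleftrightarrow> (\<forall>j<d. m' (''t'', [j]) = m (''t'', [j]))"

definition keeps :: "nat \<Rightarrow> nat \<Rightarrow> memory \<Rightarrow> memory \<Rightarrow> bool" where
  "keeps k d m m' \<longleftrightarrow> frame {''v'', ''t''} m m' \<and> same_loop_vars k m m' \<and> same_temps d m m'"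

lemma keeps_refl [simp]: "keeps k d m m"
  by (simp add: keeps_def frame_def same_loop_vars_def same_temps_def)

lemma keeps_trans: "keeps k d m m' \<Longrightarrow> keeps k d m' m'' \<Longrightarrow> keeps k d m m''"
  by (simp add: keeps_def frame_def same_loop_vars_def same_temps_def)

lemma keeps_Suc_temp: "keeps k (Suc d) m m' \<Longrightarrow> keeps k d m m'"
  by (simp add: keeps_def same_temps_def)

lemma keeps_n: "keeps k d m m' \<Longrightarrow> m' (''n'', []) = m (''n'', [])"
  by (simp add: keeps_def frame_def)

lemma keeps_temp: "keeps k (Suc d) m m' \<Longrightarrow> m' (''t'', [d]) = m (''t'', [d])"
  by (simp add: keeps_def same_temps_def)

lemma keeps_upd_temp [simp]: "keeps k d m (m'((''t'', [d]) := x)) \<longleftrightarrow> keeps k d m m'"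
  by (auto simp: keeps_def frame_def same_loop_vars_def same_temps_def)

lemma keeps_upd_var [simp]: "keeps k d m (m'((''v'', [k]) := x)) \<longleftrightarrow> keeps k d m m'"
  by (auto simp: keeps_def frame_def same_loop_vars_def same_temps_def)

lemma beval_keeps:
  assumes "wf_bexpr A k b" "A \<notin> {''v'', ''t'', ''n''}" "keeps k d m m'"
  shows "beval m' b = beval m b"
  using assms by (intro beval_cong[of A k]) (auto simp: keeps_def frame_def same_row_def)

lemma compile_correct:
  assumes "wf_bexpr A k b" "A \<notin> {''v'', ''t'', ''n''}" "m (''n'', []) = N"
  shows "\<exists>t m'. exec (compile d b) m t m' \<and> t \<le> cost N b \<and> keeps k d m m' \<and> m' (''t'', [d]) = beval m b"
  using assms
proof (induction b arbitrary: k d m)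
  case (Pure e)
  let ?m = "m((''t'', [d]) := eval_expr m e)"
  have "exec (compile d (Pure e)) m 1 ?m"
    unfolding compile.simps by (rule exec_AssignI) simp_all
  moreover have "keeps k d m ?m" by (simp only: keeps_upd_temp keeps_refl)
  moreover have "?m (''t'', [d]) = beval m (Pure e)" by simp
  moreover have "1 \<le> cost N (Pure e)" by simp
  ultimately show ?case by blast
next
  case (Add a b)
  have wf: "wf_bexpr A k a" "wf_bexpr A k b" using Add.prems by auto
  obtain t1 m1 where m1: "exec (compile d a) m t1 m1" "t1 \<le> cost N a" "keeps k d m m1" "m1 (''t'', [d]) = beval m a"
    using Add.IH(1)[where m = m and d = d, OF wf(1) Add.prems(2,3)] by blast
  have n1: "m1 (''n'', []) = N" using Add.prems(3) keeps_n[OF m1(3)] by simp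
  obtain t2 m2 where m2: "exec (compile (Suc d) b) m1 t2 m2" "t2 \<le> cost N b" "keeps k (Suc d) m1 m2"
      "m2 (''t'', [Suc d]) = beval m1 b"
    using Add.IH(2)[where m = m1 and d = "Suc d", OF wf(2) Add.prems(2) n1] by blast
  let ?m3 = "m2((''t'', [d]) := m2 (''t'', [d]) + m2 (''t'', [Suc d]))"
  have "exec (compile d (Add a b)) m (t1 + (t2 + 1)) ?m3"
    unfolding compile.simps by (rule exec.Seq[OF m1(1) exec.Seq[OF m2(1) exec_AssignI]]) simp_all
  moreover have "t1 + (t2 + 1) \<le> cost N (Add a b)" using m1(2) m2(2) by simp
  moreover have "keeps k d m ?m3"
    using keeps_trans[OF m1(3) keeps_Suc_temp[OF m2(3)]] by (simp only: keeps_upd_temp)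
  moreover have "?m3 (''t'', [d]) = beval m (Add a b)"
    using m2(4) m1(4) keeps_temp[OF m2(3)] beval_keeps[OF wf(2) Add.prems(2) m1(3)] by simp
  ultimately show ?case by blast
next
  case (Sub a b)
  have wf: "wf_bexpr A k a" "wf_bexpr A k b" using Sub.prems by auto
  obtain t1 m1 where m1: "exec (compile d a) m t1 m1" "t1 \<le> cost N a" "keeps k d m m1" "m1 (''t'', [d]) = beval m a"
    using Sub.IH(1)[where m = m and d = d, OF wf(1) Sub.prems(2,3)] by blast
  have n1: "m1 (''n'', []) = N" using Sub.prems(3) keeps_n[OF m1(3)] by simp
  obtain t2 m2 where m2: "exec (compile (Suc d) b) m1 t2 m2" "t2 \<le> cost N b" "keeps k (Suc d) m1 m2"
      "m2 (''t'', [Suc d]) = beval m1 b"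
    using Sub.IH(2)[where m = m1 and d = "Suc d", OF wf(2) Sub.prems(2) n1] by blast
  let ?m3 = "m2((''t'', [d]) := m2 (''t'', [d]) - m2 (''t'', [Suc d]))"
  have "exec (compile d (Sub a b)) m (t1 + (t2 + 1)) ?m3"
    unfolding compile.simps by (rule exec.Seq[OF m1(1) exec.Seq[OF m2(1) exec_AssignI]]) simp_all
  moreover have "t1 + (t2 + 1) \<le> cost N (Sub a b)" using m1(2) m2(2) by simp
  moreover have "keeps k d m ?m3"
    using keeps_trans[OF m1(3) keeps_Suc_temp[OF m2(3)]] by (simp only: keeps_upd_temp)
  moreover have "?m3 (''t'', [d]) = beval m (Sub a b)"
    using m2(4) m1(4) keeps_temp[OF m2(3)] beval_keeps[OF wf(2) Sub.prems(2) m1(3)] by simp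
  ultimately show ?case by blast
next
  case (Cond c a b)
  have wf: "wf_bexpr A k c" "wf_bexpr A k a" "wf_bexpr A k b" using Cond.prems by auto
  obtain t1 m1 where m1: "exec (compile d c) m t1 m1" "t1 \<le> cost N c" "keeps k d m m1" "m1 (''t'', [d]) = beval m c"
    using Cond.IH(1)[where m = m and d = d, OF wf(1) Cond.prems(2,3)] by blast
  have n1: "m1 (''n'', []) = N" using Cond.prems(3) keeps_n[OF m1(3)] by simp
  define x where "x = (if beval m c \<noteq> 0 then a else b)"
  have x: "wf_bexpr A k x" "cost N x \<le> cost N a + cost N b" "beval m x = beval m (Cond c a b)"
    using wf by (simp_all add: x_def)
  have "\<exists>t2 m2. exec (compile d x) m1 t2 m2 \<and> t2 \<le> cost N x \<and> keeps k d m1 m2 \<and> m2 (''t'', [d]) = beval m1 x"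
    using Cond.IH(2)[where m = m1 and d = d, OF wf(2) Cond.prems(2) n1]
      Cond.IH(3)[where m = m1 and d = d, OF wf(3) Cond.prems(2) n1] unfolding x_def by (cases "beval m c = 0") simp_all
  then obtain t2 m2 where m2: "exec (compile d x) m1 t2 m2" "t2 \<le> cost N x" "keeps k d m1 m2" "m2 (''t'', [d]) = beval m1 x"
    by blast
  have "exec (If (tv d) (compile d a) (compile d b)) m1 (t2 + 1) m2"
  proof (cases "beval m c = 0")
    case True
    then show ?thesis using m1(4) m2(1) by (intro exec.IfFalse) (simp_all add: x_def)
  next
    case False
    then show ?thesis using m1(4) m2(1) by (intro exec.IfTrue) (simp_all add: x_def)
  qed
  then have "exec (compile d (Cond c a b)) m (t1 + (t2 + 1)) m2"
    unfolding compile.simps by (rule exec.Seq[OF m1(1)])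
  moreover have "t1 + (t2 + 1) \<le> cost N (Cond c a b)" using m1(2) m2(2) x(2) by simp
  moreover have "m2 (''t'', [d]) = beval m (Cond c a b)"
    using m2(4) beval_keeps[OF x(1) Cond.prems(2) m1(3)] x(3) by simp
  ultimately show ?case using keeps_trans[OF m1(3) m2(3)] by blast
next
  case (Sum j b)
  have wf: "j = k" "wf_bexpr A (Suc k) b" using Sum.prems by auto
  let ?as = "Assign ''t'' [Const d] (Plus (tv d) (tv (Suc d)))"
  let ?P = "\<lambda>i m'. keeps k d m m' \<and> m' (''t'', [d]) = (\<Sum>j<i. beval (m((''v'', [k]) := j)) b)"
  let ?m0 = "m((''t'', [d]) := 0)"
  have "\<exists>t m'. exec (loop k (Seq (compile (Suc d) b) ?as)) ?m0 t m' \<and> t \<le> N * ((cost N b + 1) + 2) + 2 \<and>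
     ?P N m' \<and> m' (''n'', []) = N"
  proof (rule loop_rule[where P = ?P])
    fix i m1 assume i: "i < N" and P: "?P i m1" and n: "m1 (''n'', []) = N" and v: "m1 (''v'', [k]) = i"
    obtain t2 m2 where m2: "exec (compile (Suc d) b) m1 t2 m2" "t2 \<le> cost N b" "keeps (Suc k) (Suc d) m1 m2"
      "m2 (''t'', [Suc d]) = beval m1 b"
      using Sum.IH[where m = m1 and d = "Suc d", OF wf(2) Sum.prems(2) n] by blast
    \<comment> \<open>The partial sum in the invariant refers to the initial memory
      \<open>m\<close>. The current memory agrees with it, once the loop variable is set to
      \<open>i\<close>, on all that \<open>b\<close> may read.\<close>
    have "keeps (Suc k) d (m((''v'', [k]) := i)) m1"
      using P v by (auto simp: keeps_def frame_def same_loop_vars_def same_temps_def less_Suc_eq)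
    then have "beval m1 b = beval (m((''v'', [k]) := i)) b"
      by (rule beval_keeps[OF wf(2) Sum.prems(2)])
    then have val: "m2 (''t'', [Suc d]) = beval (m((''v'', [k]) := i)) b" using m2(4) by simp
    define m3 where "m3 = m2((''t'', [d]) := m2 (''t'', [d]) + m2 (''t'', [Suc d]))"
    have "exec (Seq (compile (Suc d) b) ?as) m1 (t2 + 1) m3"
      unfolding m3_def by (rule exec.Seq[OF m2(1) exec_AssignI]) simp_all
    moreover have "keeps k d m1 m2"
      using m2(3) by (auto simp: keeps_def same_loop_vars_def same_temps_def)
    then have "keeps k d m m2" using P keeps_trans by blast
    moreover have "m3 (''n'', []) = N" "m3 (''v'', [k]) = i"
      using keeps_n[OF m2(3)] m2(3) n v by (auto simp: m3_def keeps_def same_loop_vars_def)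
    moreover have "?P (Suc i) (m3((''v'', [k]) := Suc i))"
      using P keeps_temp[OF m2(3)] val \<open>keeps k d m m2\<close> unfolding m3_def by (simp only: keeps_upd_temp keeps_upd_var) simp
    ultimately show "\<exists>t m'. exec (Seq (compile (Suc d) b) ?as) m1 t m' \<and> t \<le> cost N b + 1 \<and>
         ?P (Suc i) (m'((''v'', [k]) := Suc i)) \<and> m' (''n'', []) = N \<and> m' (''v'', [k]) = i"
      using m2(2) by (intro exI[of _ "t2 + 1"] exI[of _ m3] conjI) (simp_all only: add_le_cancel_right)
  next
    show "?P 0 (?m0((''v'', [k]) := 0))" "?m0 (''n'', []) = N"
      using Sum.prems(3) by (simp_all only: keeps_upd_temp keeps_upd_var keeps_refl) simp_all
  qed
  then obtain t m' where m': "exec (loop k (Seq (compile (Suc d) b) ?as)) ?m0 t m'" "t \<le> N * ((cost N b + 1) + 2) + 2"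
     "?P N m'" by blast
  have "exec (compile d (Sum j b)) m (1 + t) m'"
    unfolding compile.simps wf(1) by (rule exec.Seq[OF exec_AssignI m'(1)]) simp_all
  moreover have "1 + t \<le> cost N (Sum j b)" using m'(2) by (simp add: algebra_simps)
  moreover have "keeps k d m m'" "m' (''t'', [d]) = beval m (Sum j b)" using m'(3) wf(1) Sum.prems(3) by simp_all
  ultimately show ?case by blast
qed

section \<open>Nested loops and tables\<close>

fun nest :: "nat \<Rightarrow> nat \<Rightarrow> prog \<Rightarrow> prog" where
  "nest 0 l c = c"
| "nest (Suc k) l c = loop l (nest k (Suc l) c)"

fun nest_cost :: "nat \<Rightarrow> nat \<Rightarrow> nat \<Rightarrow> nat" where
  "nest_cost N 0 T = T"
| "nest_cost N (Suc k) T = N * (nest_cost N k T + 2) + 2"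

definition tuples :: "nat \<Rightarrow> nat \<Rightarrow> nat list set" where
  "tuples k N = {is. length is = k \<and> set is \<subseteq> {..<N}}"

definition loop_vars :: "nat list \<Rightarrow> memory \<Rightarrow> bool" where
  "loop_vars is m \<longleftrightarrow> (\<forall>j<length is. m (''v'', [j]) = is ! j)"

text \<open>The invariant is indexed by the set of index tuples that have already been visited, so that
  it does not depend on the order of the iterations.\<close>

lemma nest_rule:
  assumes body: "\<And>D is m. is \<in> tuples k N \<Longrightarrow> P D m \<Longrightarrow> loop_vars (ps @ is) m \<Longrightarrow>
      \<exists>t m'. exec c m t m' \<and> t \<le> T \<and> P (insert (ps @ is) D) m' \<and> loop_vars (ps @ is) m'"
    and inv: "\<And>D m k x. P D m \<Longrightarrow> P D (m((''v'', [k]) := x))"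
    and n: "\<And>D m. P D m \<Longrightarrow> m (''n'', []) = N"
    and init: "P D m" "loop_vars ps m"
  shows "\<exists>t m'. exec (nest k (length ps) c) m t m' \<and> t \<le> nest_cost N k T \<and>
           P (D \<union> (\<lambda>is. ps @ is) ` tuples k N) m' \<and> loop_vars ps m'"
  using body init
proof (induction k arbitrary: ps D m)
  case 0
  have "tuples 0 N = {[]}" by (auto simp: tuples_def)
  then show ?case using "0.prems"(1)[of "[]" D m] 0 by auto
next
  case (Suc k)
  let ?l = "length ps"
  let ?D = "\<lambda>i. D \<union> (\<lambda>is. ps @ is) ` {j # is | j is. j < i \<and> is \<in> tuples k N}"
  let ?Q = "\<lambda>i m. P (?D i) m \<and> loop_vars ps m"
  have *: "\<exists>t m'. exec (loop ?l (nest k (Suc ?l) c)) m t m' \<and> t \<le> N * (nest_cost N k T + 2) + 2 \<and> ?Q N m' \<and> m' (''n'', []) = N"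
  proof (rule loop_rule[where P = ?Q])
    fix i m assume i: "i < N" and Q: "?Q i m" and v: "m (''v'', [?l]) = i"
    have "\<exists>t m'. exec (nest k (length (ps @ [i])) c) m t m' \<and> t \<le> nest_cost N k T \<and>
           P (?D i \<union> (\<lambda>is. (ps @ [i]) @ is) ` tuples k N) m' \<and> loop_vars (ps @ [i]) m'"
    proof (rule Suc.IH)
      fix D ix m assume "ix \<in> tuples k N" "P D m" "loop_vars ((ps @ [i]) @ ix) m"
      then show "\<exists>t m'. exec c m t m' \<and> t \<le> T \<and> P (insert ((ps @ [i]) @ ix) D) m' \<and> loop_vars ((ps @ [i]) @ ix) m'"
        using Suc.prems(1)[of "i # ix" D m] i by (auto simp: tuples_def)
    qed (use Q v in \<open>auto simp: loop_vars_def nth_append less_Suc_eq\<close>)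
    then obtain t m' where m': "exec (nest k (Suc ?l) c) m t m'" "t \<le> nest_cost N k T"
        "P (?D i \<union> (\<lambda>is. (ps @ [i]) @ is) ` tuples k N) m'" and vars: "loop_vars (ps @ [i]) m'"
      unfolding length_append_singleton by blast
    have D: "?D i \<union> (\<lambda>is. (ps @ [i]) @ is) ` tuples k N = ?D (Suc i)"
      by (auto simp: less_Suc_eq)
    have "loop_vars ps (m'((''v'', [?l]) := Suc i))" "m' (''v'', [?l]) = i"
      using vars by (auto simp: loop_vars_def nth_append less_Suc_eq)
    then show "\<exists>t m'. exec (nest k (Suc ?l) c) m t m' \<and> t \<le> nest_cost N k T \<and>
        ?Q (Suc i) (m'((''v'', [?l]) := Suc i)) \<and> m' (''n'', []) = N \<and> m' (''v'', [?l]) = i"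
      using m' n inv[of _ m'] unfolding D by blast
  next
    show "?Q 0 (m((''v'', [?l]) := 0))" using Suc.prems inv by (auto simp: loop_vars_def)
  qed (use n Suc.prems in auto)
  have D: "?D N = D \<union> (\<lambda>is. ps @ is) ` tuples (Suc k) N"
    by (fastforce simp: tuples_def length_Suc_conv image_iff)
  show ?case using * unfolding D nest.simps nest_cost.simps by blast
qed

text \<open>Restores the loop variables of an earlier iteration, so that the equation defining a
  table entry can still be stated after the loops have moved on.\<close>

definition with_vars :: "nat list \<Rightarrow> memory \<Rightarrow> memory" where
  "with_vars is m = (\<lambda>(x, js). if x = ''v'' \<and> length js = 1 \<and> hd js < length is then is ! hd js else m (x, js))"

lemma with_vars_var [simp]: "j < length js \<Longrightarrow> with_vars js m (''v'', [j]) = js ! j"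
  by (simp add: with_vars_def)

lemma with_vars_other [simp]: "x \<noteq> ''v'' \<Longrightarrow> with_vars js m (x, ix) = m (x, ix)"
  by (simp add: with_vars_def)

lemma beval_with_vars_cong:
  assumes "wf_bexpr A (length js) b" "A \<notin> {''v'', ''t'', ''n''}" "js \<noteq> []"
    "frame {''v'', ''t'', A} m m'" "same_row A (hd js) m m'"
  shows "beval (with_vars js m') b = beval (with_vars js m) b"
proof (rule beval_cong[OF assms(1,2)])
  have v: "A \<noteq> ''v''" using assms(2) by simp
  show "frame {''v'', ''t'', A} (with_vars js m) (with_vars js m')"
    using assms(4) by (simp add: frame_def)
  show "same_loop_vars (length js) (with_vars js m) (with_vars js m')"
    by (simp add: same_loop_vars_def)
  fix t assume "0 < length js \<longrightarrow> t = with_vars js m (''v'', [0])"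
  then have "t = hd js" using assms(3) by (simp add: hd_conv_nth)
  then show "same_row A t (with_vars js m) (with_vars js m')"
    using assms(5) v by (simp add: same_row_def)
qed

lemma beval_loop_vars:
  assumes "wf_bexpr A (length js) b" "A \<notin> {''v'', ''t'', ''n''}" "loop_vars js m"
  shows "beval m b = beval (with_vars js m) b"
proof (rule beval_cong[OF assms(1,2)])
  have v: "A \<noteq> ''v''" using assms(2) by simp
  show "frame {''v'', ''t'', A} (with_vars js m) m"
    by (simp add: frame_def)
  show "same_loop_vars (length js) (with_vars js m) m"
    using assms(3) by (simp add: same_loop_vars_def loop_vars_def)
  show "same_row A t (with_vars js m) m" for t
    using v by (simp add: same_row_def)
qed

text \<open>The row with index \<open>t + 1\<close> of the table is computed from the row with index \<open>t\<close>.\<close>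

definition table :: "string \<Rightarrow> nat \<Rightarrow> bexpr \<Rightarrow> prog" where
  "table A k b = loop 0 (nest k 1 (Seq (compile 0 b)
     (Assign A (Plus (lv 0) (Const 1) # map lv [1..<Suc k]) (tv 0))))"

lemma eval_loop_vars:
  assumes "loop_vars (t # js) m" "length js = k"
  shows "map (eval_expr m) (Plus (lv 0) (Const 1) # map lv [1..<Suc k]) = Suc t # js"
proof -
  have "m (''v'', [0]) = t" using assms by (auto simp: loop_vars_def)
  moreover have "map (eval_expr m) (map lv [1..<Suc k]) = js"
  proof (rule nth_equalityI)
    fix i assume "i < length (map (eval_expr m) (map lv [1..<Suc k]))"
    then have i: "i < k" by (simp del: upt_Suc)
    then have "m (''v'', [Suc i]) = (t # js) ! Suc i" using assms unfolding loop_vars_def by (metis Suc_less_eq length_Cons)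
    then show "map (eval_expr m) (map lv [1..<Suc k]) ! i = js ! i" using i by (simp del: upt_Suc)
  qed (use assms in \<open>simp del: upt_Suc\<close>)
  ultimately show ?thesis by (simp del: upt_Suc)
qed

lemma table_body:
  fixes t N :: nat and m :: memory
  assumes A: "A \<notin> {''v'', ''t'', ''n''}" and wf: "wf_bexpr A (Suc k) b" and n: "m (''n'', []) = N"
    and vars: "loop_vars (t # js) m" "length js = k"
  defines "P \<equiv> \<lambda>D m. \<forall>i ix. i # ix \<in> D \<longrightarrow> i \<le> t \<and> length ix = k \<and> m (A, Suc i # ix) = beval (with_vars (i # ix) m) b"
  assumes P: "P D m"
  shows "\<exists>u m'. exec (Seq (compile 0 b) (Assign A (Plus (lv 0) (Const 1) # map lv [1..<Suc k]) (tv 0))) m u m' \<and>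
     u \<le> cost N b + 1 \<and> frame {''v'', ''t'', A} m m' \<and> same_row A 0 m m' \<and>
     P (insert (t # js) D) m' \<and> loop_vars (t # js) m'"
proof -
  obtain u m2 where m2: "exec (compile 0 b) m u m2" "u \<le> cost N b" "keeps (Suc k) 0 m m2" "m2 (''t'', [0]) = beval m b"
    using compile_correct[where d = 0 and m = m, OF wf A n] by blast
  have vars2: "loop_vars (t # js) m2"
    using m2(3) vars by (simp add: keeps_def same_loop_vars_def loop_vars_def)
  define m3 where "m3 = m2((A, Suc t # js) := beval m b)"
  have ex: "exec (Seq (compile 0 b) (Assign A (Plus (lv 0) (Const 1) # map lv [1..<Suc k]) (tv 0))) m (u + 1) m3"
    unfolding m3_def
    by (rule exec.Seq[OF m2(1) exec_AssignI]) (use eval_loop_vars[OF vars2 vars(2)] m2(4) in \<open>simp_all only: eval_expr.simps list.map\<close>)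
  have fr2: "frame {''v'', ''t''} m m2" using m2(3) by (simp add: keeps_def)
  have fr: "frame {''v'', ''t'', A} m m3"
    using fr2 by (simp add: frame_def m3_def)
  have rows: "same_row A i m m3" if "i \<noteq> Suc t" for i
    using fr2 A that by (simp add: same_row_def m3_def frame_def)
  \<comment> \<open>An entry computed for index \<open>i\<close> reads only row
    \<open>i \<le> t\<close>, while the write goes to row \<open>t + 1\<close>.\<close>
  have val: "beval (with_vars (i # ix) m3) b = beval (with_vars (i # ix) m) b" if "i \<le> t" "length ix = k" for i ix
    using that wf rows[of i] by (intro beval_with_vars_cong[OF _ A _ fr]) auto
  have "loop_vars (t # js) m3" using vars2 A by (simp add: loop_vars_def m3_def)
  moreover have "P (insert (t # js) D) m3"
    unfolding P_def
  proof (intro allI impI)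
    fix i ix assume "i # ix \<in> insert (t # js) D"
    then consider "i = t" "ix = js" | "i # ix \<in> D" "(i, ix) \<noteq> (t, js)" by auto
    then show "i \<le> t \<and> length ix = k \<and> m3 (A, Suc i # ix) = beval (with_vars (i # ix) m3) b"
    proof cases
      case 1
      have "beval m b = beval (with_vars (t # js) m) b"
        using wf A vars by (intro beval_loop_vars[of A]) simp_all
      then have "m3 (A, Suc i # ix) = beval (with_vars (i # ix) m) b" using 1 by (simp add: m3_def)
      then show ?thesis using 1 val[of t js] vars(2) by simp
    next
      case 2
      then have *: "i \<le> t" "length ix = k" "m (A, Suc i # ix) = beval (with_vars (i # ix) m) b"
        using P by (auto simp: P_def)
      have "m3 (A, Suc i # ix) = m2 (A, Suc i # ix)" using 2(2) by (auto simp: m3_def)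
      also have "\<dots> = m (A, Suc i # ix)" using A by (intro frameD[OF fr2]) auto
      finally show ?thesis using * val[of i ix] by simp
    qed
  qed
  ultimately show ?thesis using ex m2(2) fr rows[of 0] by (intro exI[of _ "u + 1"] exI[of _ m3]) simp
qed

definition table_cost :: "nat \<Rightarrow> nat \<Rightarrow> bexpr \<Rightarrow> nat" where
  "table_cost N k b = N * (nest_cost N k (cost N b + 1) + 2) + 2"

lemma frame_trans: "frame X m m' \<Longrightarrow> frame X m' m'' \<Longrightarrow> frame X m m''"
  by (simp add: frame_def)

text \<open>The recurrence holds in the final memory because a row is complete before the next one
  reads it. The untouched row 0 is the base case.\<close>

lemma table_correct:
  fixes N :: nat and m :: memory
  assumes A: "A \<notin> {''v'', ''t'', ''n''}" and wf: "wf_bexpr A (Suc k) b" and n: "m (''n'', []) = N"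
  shows "\<exists>u m'. exec (table A k b) m u m' \<and> u \<le> table_cost N k b \<and> frame {''v'', ''t'', A} m m' \<and>
     same_row A 0 m m' \<and>
     (\<forall>i<N. \<forall>ix\<in>tuples k N. m' (A, Suc i # ix) = beval (with_vars (i # ix) m') b)"
proof -
  define F where "F = (\<lambda>m'. frame {''v'', ''t'', A} m m' \<and> same_row A 0 m m')"
  define P where "P = (\<lambda>t D m. \<forall>i ix. i # ix \<in> D \<longrightarrow> i \<le> (t::nat) \<and> length ix = k \<and>
      m (A, Suc i # ix) = beval (with_vars (i # ix) m) b)"
  define D where "D = (\<lambda>t. {i # ix | i ix. i < t \<and> ix \<in> tuples k N})"
  have nF: "m' (''n'', []) = N" if "F m'" for m'
    using that A n by (auto simp: F_def dest: frameD[where x = "''n''" and ix = "[]"])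
  have upd: "F (m'((''v'', [j]) := x)) \<and> P t E (m'((''v'', [j]) := x))" if "F m' \<and> P t E m'" for m' j x t E
  proof -
    have v: "A \<noteq> ''v''" using A by simp
    have "F (m'((''v'', [j]) := x))" using that v by (simp add: F_def frame_def same_row_def)
    moreover have "beval (with_vars (i # ix) (m'((''v'', [j]) := x))) b = beval (with_vars (i # ix) m') b"
      if "length ix = k" for i ix
      using that wf v by (intro beval_with_vars_cong[OF _ A]) (simp_all add: frame_def same_row_def)
    then have "P t E (m'((''v'', [j]) := x))" using that v by (simp add: P_def)
    ultimately show ?thesis ..
  qed
  let ?c = "Seq (compile 0 b) (Assign A (Plus (lv 0) (Const 1) # map lv [1..<Suc k]) (tv 0))"
  let ?Q = "\<lambda>t m'. F m' \<and> P t (D t) m'"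
  have "\<exists>u m'. exec (loop 0 (nest k 1 ?c)) m u m' \<and> u \<le> table_cost N k b \<and> ?Q N m' \<and> m' (''n'', []) = N"
    unfolding table_cost_def
  proof (rule loop_rule[where P = ?Q])
    fix t m1 assume t: "t < N" and Q: "?Q t m1" and v: "m1 (''v'', [0]) = t"
    have "\<exists>u m'. exec (nest k (length [t]) ?c) m1 u m' \<and> u \<le> nest_cost N k (cost N b + 1) \<and>
        (F m' \<and> P t (D t \<union> (\<lambda>ix. [t] @ ix) ` tuples k N) m') \<and> loop_vars [t] m'"
    proof (rule nest_rule[where P = "\<lambda>D m'. F m' \<and> P t D m'"])
      fix E js m2 assume js: "js \<in> tuples k N" and FP: "F m2 \<and> P t E m2" and lv: "loop_vars ([t] @ js) m2"
      have lv': "loop_vars (t # js) m2" "length js = k" using lv js by (simp_all add: tuples_def)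
      obtain u m' where m': "exec ?c m2 u m'" "u \<le> cost N b + 1" "frame {''v'', ''t'', A} m2 m'"
         "same_row A 0 m2 m'" "P t (insert (t # js) E) m'" "loop_vars (t # js) m'"
        using table_body[where m = m2 and N = N and D = E, OF A wf _ lv'] FP nF[of m2] unfolding P_def by blast
      have "F m'" using FP m'(3,4) frame_trans unfolding F_def by (auto simp: same_row_def)
      then show "\<exists>u m'. exec ?c m2 u m' \<and> u \<le> cost N b + 1 \<and> (F m' \<and> P t (insert ([t] @ js) E) m') \<and> loop_vars ([t] @ js) m'"
        using m' by (simp only: append_Cons append_Nil) blast
    next
      show "F m1 \<and> P t (D t) m1" by (rule Q)
      show "loop_vars [t] m1" using v by (simp add: loop_vars_def)
    qed (use upd nF in blast)+
    then obtain u m' where m': "exec (nest k 1 ?c) m1 u m'" "u \<le> nest_cost N k (cost N b + 1)"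
      "F m'" "P t (D t \<union> (\<lambda>ix. [t] @ ix) ` tuples k N) m'" "loop_vars [t] m'" by auto
    have "D t \<union> (\<lambda>ix. [t] @ ix) ` tuples k N = D (Suc t)" by (auto simp: D_def less_Suc_eq)
    then have "P (Suc t) (D (Suc t)) m'" using m'(4) unfolding P_def by (metis le_SucI)
    then have "?Q (Suc t) (m'((''v'', [0]) := Suc t))" using upd m'(3) by blast
    moreover have "m' (''v'', [0]) = t" using m'(5) by (simp add: loop_vars_def)
    ultimately show "\<exists>u m'. exec (nest k 1 ?c) m1 u m' \<and> u \<le> nest_cost N k (cost N b + 1) \<and>
        ?Q (Suc t) (m'((''v'', [0]) := Suc t)) \<and> m' (''n'', []) = N \<and> m' (''v'', [0]) = t"
      using m'(1,2) nF[OF m'(3)] by blast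
  next
    have "F m" by (simp add: F_def frame_def same_row_def)
    moreover have "P 0 (D 0) m" by (simp add: P_def D_def)
    ultimately show "?Q 0 (m((''v'', [0]) := 0))" using upd by blast
  qed (rule n)
  then obtain u m' where m': "exec (loop 0 (nest k 1 ?c)) m u m'" "u \<le> table_cost N k b" "F m'" "P N (D N) m'" by blast
  have "m' (A, Suc i # ix) = beval (with_vars (i # ix) m') b" if "i < N" "ix \<in> tuples k N" for i ix
  proof -
    have "i # ix \<in> D N" using that by (simp add: D_def)
    then show ?thesis using m'(4) by (simp add: P_def)
  qed
  then show ?thesis using m'(1-3) unfolding table_def F_def by blast
qed

section \<open>Polynomial bounds on the cost\<close>

definition poly_bounded :: "(nat \<Rightarrow> nat) \<Rightarrow> bool" where
  "poly_bounded f \<longleftrightarrow> (\<exists>q :: nat poly. \<forall>N. f N \<le> poly q N)"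

lemma poly_bounded_const: "poly_bounded (\<lambda>N. c)"
  unfolding poly_bounded_def by (intro exI[of _ "[:c:]"]) simp

lemma poly_bounded_id: "poly_bounded (\<lambda>N. N)"
  unfolding poly_bounded_def by (intro exI[of _ "[:0, 1:]"]) simp

lemma poly_bounded_add: "poly_bounded f \<Longrightarrow> poly_bounded g \<Longrightarrow> poly_bounded (\<lambda>N. f N + g N)"
  unfolding poly_bounded_def by (metis poly_add add_mono)

lemma poly_bounded_mult: "poly_bounded f \<Longrightarrow> poly_bounded g \<Longrightarrow> poly_bounded (\<lambda>N. f N * g N)"
  unfolding poly_bounded_def by (metis poly_mult mult_le_mono)

lemmas poly_bounded_intros = poly_bounded_const poly_bounded_id poly_bounded_add poly_bounded_mult

lemma poly_bounded_cost: "poly_bounded (\<lambda>N. cost N b)"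
  by (induction b) (simp_all only: cost.simps, (intro poly_bounded_intros; assumption)+)

lemma poly_bounded_nest_cost:
  assumes "poly_bounded T"
  shows "poly_bounded (\<lambda>N. nest_cost N k (T N))"
proof (induction k)
  case 0
  show ?case using assms unfolding nest_cost.simps .
next
  case (Suc k)
  then show ?case unfolding nest_cost.simps by (intro poly_bounded_intros)
qed

lemma poly_bounded_table_cost: "poly_bounded (\<lambda>N. table_cost N k b)"
  unfolding table_cost_def
  by (intro poly_bounded_intros poly_bounded_nest_cost poly_bounded_cost)

section \<open>Evaluating the messages\<close>

text \<open>A labelling supplies \<open>s\<close> as a vertex of least label among those with a
  cycle edge, and \<open>a\<close> as that label. Labels are at most \<open>card V\<close>, which
  bounds both the range of \<open>a\<close> and the number of rounds.\<close>

lemma transitivity_ge_iff: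
  assumes G: "unicyclic G" and k: "1 \<le> k"
  defines "V \<equiv> verts G" and "R \<equiv> adjacent G"
  shows "k \<le> transitivity G \<longleftrightarrow>
    (\<exists>s\<in>V. \<exists>a. 1 \<le> a \<and> a \<le> card V \<and> (\<exists>v\<in>V. (\<exists>x\<in>V. cycle_edge R s x) \<and>
       a \<le> msg V (cut_cycle R s) (cycle_edge R s) a (card V) s s \<and>
       k \<le> msg V (cut_cycle R s) (cycle_edge R s) a (card V) v v))" (is "_ \<longleftrightarrow> ?rhs")
proof -
  have simple: "simple_graph G" and ne: "V \<noteq> {}" using G by (auto simp: unicyclic_def connected_graph_def V_def)
  have R: "symp R" "irreflp R" "\<And>y z. R y z \<Longrightarrow> y \<in> V \<and> z \<in> V" "finite V"
    using simple unfolding R_def V_def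
    by (auto simp: simple_graph_def intro: adjacent_symp adjacent_irreflp dest: adjacent_verts[OF simple])
  note bounds = transitivity_bounds[OF simple ne[unfolded V_def], folded V_def R_def]
  show ?thesis
  proof
    assume "k \<le> transitivity G"
    then obtain c v where c: "trans_labelling V R c" "v \<in> V" "c v = k" using bounds(2)[OF k] by blast
    have le: "c x \<le> card V" if "x \<in> V" for x
    proof -
      have "1 \<le> c x" using c(1) that by (simp add: trans_labelling_def)
      \<comment> \<open>Every label in use is itself the size of a transitive partition.\<close>
      then have "c x \<le> transitivity G" using bounds(2)[of "c x"] c(1) that by blast
      then show ?thesis using bounds(1) by (rule le_trans)
    qed
    obtain C where "is_cycle G C" using G by (auto simp: unicyclic_def)
    then obtain s0 x0 where "cycle_edge R s0 x0" using is_cycle_cycle_edge unfolding R_def by blast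
    then obtain s where s: "\<exists>x. cycle_edge R s x" "\<And>y. \<exists>x. cycle_edge R y x \<Longrightarrow> c s \<le> c y"
      using ex_has_least_nat[of "\<lambda>y. \<exists>x. cycle_edge R y x" s0 c] by blast
    obtain x where x: "cycle_edge R s x" using s(1) by blast
    have sx: "s \<in> V" "x \<in> V" using x R(3) by (auto simp: cycle_edge_def)
    have min: "c s \<le> c y" if "cycle_edge R y z" for y z using s(2) that by blast
    have complete: "c y \<le> msg V (cut_cycle R s) (cycle_edge R s) (c s) (card V) y y" if "y \<in> V" for y
      using that le[OF that] by (intro msg_complete[OF R c(1) le min]) auto
    have "1 \<le> c s" using c(1) sx(1) by (simp add: trans_labelling_def)
    then show ?rhs using sx x le[OF sx(1)] complete[OF sx(1)] complete[OF c(2)] c(2,3) by blast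
  next
    assume ?rhs
    then obtain s a v x where *: "s \<in> V" "1 \<le> a" "v \<in> V" "cycle_edge R s x"
      "a \<le> msg V (cut_cycle R s) (cycle_edge R s) a (card V) s s"
      "k \<le> msg V (cut_cycle R s) (cycle_edge R s) a (card V) v v" by blast
    have forest: "\<not> cycle_edge (cut_cycle R s) w y" for w y
      using cut_forest[OF G] *(4) unfolding R_def by blast
    have "\<exists>c. trans_labelling V R c \<and> c v = k"
      by (rule cut_sound[OF R forest *(1,2,5,3) k *(6)])
    then show "k \<le> transitivity G" using bounds(2)[OF k] *(3) by blast
  qed
qed

text \<open>Walks of one to \<open>t\<close> steps from \<open>s\<close> whose first step does not
  go to \<open>x\<close> and which do not return to \<open>s\<close>. Thus \<open>y = x\<close>
  tests for a cycle edge.\<close>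

primrec reach_within :: "'a set \<Rightarrow> ('a \<Rightarrow> 'a \<Rightarrow> bool) \<Rightarrow> nat \<Rightarrow> 'a \<Rightarrow> 'a \<Rightarrow> 'a \<Rightarrow> bool" where
  "reach_within V R 0 s x y = False"
| "reach_within V R (Suc t) s x y \<longleftrightarrow>
     R s y \<and> y \<noteq> x \<or> y \<noteq> s \<and> (\<exists>z\<in>V. reach_within V R t s x z \<and> R z y)"

lemma reach_within_sound:
  "reach_within V R t s x y \<Longrightarrow> \<exists>u. u \<noteq> x \<and> R s u \<and> reach_avoiding R s u y"
proof (induction t arbitrary: y)
  case (Suc t)
  then consider "R s y" "y \<noteq> x" | z where "y \<noteq> s" "reach_within V R t s x z" "R z y" by auto
  then show ?case
  proof cases
    case 1
    then show ?thesis using reach_avoiding_refl by metis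
  next
    case 2
    then show ?thesis using Suc.IH reach_avoiding_step by metis
  qed
qed simp

lemma reach_within_Suc: "reach_within V R t s x y \<Longrightarrow> reach_within V R (Suc t) s x y"
proof (induction t arbitrary: y)
  case (Suc t)
  then show ?case unfolding reach_within.simps(2)[of V R "Suc t"] by (auto simp del: reach_within.simps(2) simp: reach_within.simps(2)[of V R t s x y])
qed simp

lemma reach_within_mono: "t \<le> t' \<Longrightarrow> reach_within V R t s x y \<Longrightarrow> reach_within V R t' s x y"
  by (induction t' rule: dec_induct) (auto dest: reach_within_Suc simp del: reach_within.simps)

text \<open>A simple path from \<open>u\<close> has at most \<open>card V\<close> vertices, and its
  vertex number \<open>i\<close> is \<open>i + 1\<close> steps away from \<open>s\<close>.\<close>

lemma cycle_edge_iff_reach_within: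
  assumes "\<And>y z. R y z \<Longrightarrow> y \<in> V \<and> z \<in> V" "finite V"
  shows "cycle_edge R s x \<longleftrightarrow> R s x \<and> reach_within V R (card V) s x x"
proof
  assume "cycle_edge R s x"
  then obtain u where u: "R s x" "u \<noteq> x" "R s u" "reach_avoiding R s u x"
    by (auto simp: cycle_edge_def)
  obtain xs where xs: "xs \<noteq> []" "distinct xs" "hd xs = u" "last xs = x"
      "successively (\<lambda>y z. R y z \<and> z \<noteq> s) xs" "\<forall>y\<in>set xs. reach_avoiding R s u y"
    using simple_path[OF u(4)[unfolded reach_avoiding_def]] unfolding reach_avoiding_def by blast
  have inV: "y \<in> V" if "reach_avoiding R s u y" for y
    using that unfolding reach_avoiding_def by (induction rule: rtranclp_induct) (use u assms in auto)
  have "reach_within V R (Suc i) s x (xs ! i)" if "i < length xs" for i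
    using that
  proof (induction i)
    case 0
    then show ?case using u xs(1,3) by (simp add: hd_conv_nth)
  next
    case (Suc i)
    have "R (xs ! i) (xs ! Suc i) \<and> xs ! Suc i \<noteq> s" using successively_nth[OF xs(5) Suc.prems] .
    moreover have "xs ! i \<in> V" using inV xs(6) Suc.prems by simp
    ultimately show ?case using Suc by (subst reach_within.simps) auto
  qed
  from this[of "length xs - 1"] have "reach_within V R (length xs) s x x"
    using xs(1,4) by (simp add: last_conv_nth del: reach_within.simps)
  moreover have "set xs \<subseteq> V" using inV xs(6) by blast
  then have "length xs \<le> card V" using card_mono[OF assms(2)] distinct_card[OF xs(2)] by metis
  ultimately show "R s x \<and> reach_within V R (card V) s x x" using u(1) reach_within_mono by metis
next
  assume "R s x \<and> reach_within V R (card V) s x x"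
  then show "cycle_edge R s x" using reach_within_sound[of V R "card V" s x x] by (auto simp: cycle_edge_def)
qed

section \<open>The program\<close>

abbreviation zero :: bexpr where "zero \<equiv> Pure (Const 0)"
abbreviation one :: bexpr where "one \<equiv> Pure (Const 1)"
text \<open>With truncated subtraction both differences vanish only if the arguments agree.\<close>

abbreviation neq :: "expr \<Rightarrow> expr \<Rightarrow> bexpr" where "neq a b \<equiv> Pure (Plus (Minus a b) (Minus b a))"
abbreviation adj :: "expr \<Rightarrow> expr \<Rightarrow> bexpr" where "adj a b \<equiv> Pure (Cell ''adj'' [a, b])"

text \<open>Entry \<open>(t, s, x, y)\<close> of the table \<open>''R''\<close> is nonzero iff
  \<^term>\<open>reach_within V R t s x y\<close>.\<close>

definition reach_expr :: bexpr where
  "reach_expr = Add (Cond (neq (lv 3) (lv 2)) (adj (lv 1) (lv 3)) zero)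
     (Cond (neq (lv 3) (lv 1))
       (Sum 4 (Cond (Pure (Cell ''R'' [lv 0, lv 1, lv 2, lv 4])) (adj (lv 4) (lv 3)) zero)) zero)"

definition cycle_expr :: "expr \<Rightarrow> expr \<Rightarrow> bexpr" where
  "cycle_expr a b = Cond (adj a b) (Pure (Cell ''R'' [Cell ''n'' [], a, b, b])) zero"

text \<open>Negation is done by exchanging branches: each nested condition is the conjunction of an
  equality with \<open>s\<close> and a cycle edge, and if it holds the result is zero.\<close>

definition cut_expr :: "expr \<Rightarrow> expr \<Rightarrow> expr \<Rightarrow> bexpr" where
  "cut_expr s y z = Cond (adj y z)
     (Cond (Cond (neq y s) zero (cycle_expr s z)) zero
        (Cond (Cond (neq z s) zero (cycle_expr s y)) zero one)) zero"

text \<open>Variables 0 to 4 are \<open>t\<close>, \<open>s\<close>, \<open>a\<close>,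
  \<open>w\<close>, \<open>p\<close>. Variables 5 and 6 are the candidate label and the threshold in
  Hall's condition, both lowered by one, and 7 is the neighbour counted. A positive difference
  \<open>F - i\<close> therefore means that the message is at least \<open>i + 1\<close>.\<close>

definition count_expr :: bexpr where
  "count_expr = Sum 7 (Cond (cut_expr (lv 1) (lv 3) (lv 7)) (Cond (neq (lv 7) (lv 4))
     (Cond (Pure (Minus (Cell ''F'' [lv 0, lv 1, lv 2, lv 7, lv 3]) (lv 6))) one zero) zero) zero)"

definition exempt_expr :: bexpr where
  "exempt_expr = Cond (cycle_expr (lv 1) (lv 3))
     (Cond (Pure (Minus (lv 6) (lv 2))) zero (Cond (Pure (Minus (lv 5) (lv 2))) one zero)) zero"

text \<open>Entry \<open>(t, s, a, w, p)\<close> of the table \<open>''F''\<close> is the message from \<open>w\<close> to \<open>p\<close> in round \<open>t\<close>.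
  Indices start at \<open>0\<close> while labels start at \<open>1\<close>, so the index \<open>a\<close> stands for the label \<open>a + 1\<close>.\<close>

definition msg_expr :: bexpr where
  "msg_expr = Sum 5 (Cond (Sum 6 (Sub (Pure (lv 5)) (Add (Add (Pure (lv 6)) count_expr) exempt_expr))) zero one)"

text \<open>Variables 0 to 3 are the candidate value lowered by one, \<open>s\<close>, the index of
  \<open>a\<close>, and \<open>v\<close>. Achievable values are downward closed, so their number is
  the answer.\<close>

definition out_expr :: bexpr where
  "out_expr = Sum 0 (Cond (Sum 1 (Sum 2 (Sum 3 (Cond (Sum 4 (cycle_expr (lv 1) (lv 4)))
     (Cond (Pure (Minus (Cell ''F'' [Cell ''n'' [], lv 1, lv 2, lv 1, lv 1]) (lv 2)))
        (Pure (Minus (Cell ''F'' [Cell ''n'' [], lv 1, lv 2, lv 3, lv 3]) (lv 0))) zero) zero)))) one zero)"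

definition transitivity_prog :: prog where
  "transitivity_prog = Seq (table ''R'' 3 reach_expr) (Seq (table ''F'' 4 msg_expr)
     (Seq (compile 0 out_expr) (Assign ''out'' [] (tv 0))))"

lemmas expr_defs = reach_expr_def cycle_expr_def cut_expr_def count_expr_def exempt_expr_def msg_expr_def out_expr_def

lemma wf_reach_expr: "wf_bexpr ''R'' (Suc 3) reach_expr"
  by (simp add: expr_defs)

lemma wf_msg_expr: "wf_bexpr ''F'' (Suc 4) msg_expr"
  by (simp add: expr_defs)

lemma wf_out_expr: "wf_bexpr ''out'' 0 out_expr"
  by (simp add: expr_defs)

lemma beval_cycle_expr:
  "beval M (cycle_expr a b) = (if M (''adj'', [eval_expr M a, eval_expr M b]) \<noteq> 0
     then M (''R'', [M (''n'', []), eval_expr M a, eval_expr M b, eval_expr M b]) else 0)"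
  by (simp add: cycle_expr_def)


lemma sum_nth_eq_card:
  assumes "distinct vs"
  shows "(\<Sum>i<length vs. if Q (vs ! i) then 1 else 0) = card {x \<in> set vs. Q x}"
proof -
  have "(\<Sum>i<length vs. if Q (vs ! i) then 1 else 0) = (\<Sum>x\<in>set vs. if Q x then 1 else (0::nat))"
    by (rule sum.reindex_bij_betw[OF bij_betw_nth[OF assms refl refl]])
  also have "\<dots> = card {x \<in> set vs. Q x}"
    by (simp add: sum.If_cases Int_def)
  finally show ?thesis .
qed

lemma sum_indicator_card: "(\<Sum>i<(n::nat). if Q i then 1 else 0) = card {i. i < n \<and> Q i}"
  by (simp add: sum.If_cases Int_def)

lemma nat_diff_add_diff_eq_0: "a - b + (b - a) = 0 \<longleftrightarrow> a = (b::nat)"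
  by auto

lemma beval_Sum_nonzero:
  "beval m (Sum k b) \<noteq> 0 \<longleftrightarrow> (\<exists>i<m (''n'', []). beval (m((''v'', [k]) := i)) b \<noteq> 0)"
  by auto

lemma beval_Cond_nonzero:
  "beval m (Cond c b zero) \<noteq> 0 \<longleftrightarrow> beval m c \<noteq> 0 \<and> beval m b \<noteq> 0"
  by simp

lemma beval_Cond_zero_one: "beval m (Cond c zero one) = (if beval m c = 0 then 1 else 0)"
  by simp

lemma beval_Cond_one_zero: "beval m (Cond c one zero) = (if beval m c \<noteq> 0 then 1 else 0)"
  by simp

text \<open>Translates Hall's condition to indices from 0. Extending the range from
  \<open>i < j\<close> to \<open>i < n\<close> is harmless because the inequality is trivial for
  \<open>i \<ge> j\<close>.\<close>

lemma feasible_Suc_iff: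
  assumes "j < n"
  shows "feasible cnt b (Suc a) (Suc j) \<longleftrightarrow>
    (\<forall>i<n. j \<le> i + cnt (Suc i) + (if b \<and> i \<le> a \<and> a < j then 1 else 0))" (is "_ \<longleftrightarrow> (\<forall>i<n. ?Q i)")
proof -
  have "feasible cnt b (Suc a) (Suc j) \<longleftrightarrow> (\<forall>i<j. ?Q i)"
    unfolding feasible_def
  proof safe
    fix i assume *: "\<forall>i. 1 \<le> i \<and> i < Suc j \<longrightarrow> Suc j \<le> i + cnt i + (if b \<and> i \<le> Suc a \<and> Suc a < Suc j then 1 else 0)" "i < j"
    then show "?Q i" using *(1)[rule_format, of "Suc i"] by simp
  next
    fix i assume *: "\<forall>i<j. ?Q i" "1 \<le> i" "i < Suc j"
    then obtain i' where "i = Suc i'" "i' < j" by (cases i) auto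
    then show "Suc j \<le> i + cnt i + (if b \<and> i \<le> Suc a \<and> Suc a < Suc j then 1 else 0)"
      using *(1)[rule_format, of i'] by simp
  qed
  also have "\<dots> \<longleftrightarrow> (\<forall>i<n. ?Q i)"
  proof safe
    fix i assume "\<forall>i<j. ?Q i"
    then show "?Q i" by (cases "i < j") auto
  qed (use assms in auto)
  finally show ?thesis .
qed

section \<open>Correctness of the program\<close>

locale enumerated_graph =
  fixes G :: "'a graph" and vs :: "'a list"
  assumes simple: "simple_graph G" and distinct: "distinct vs" and set_vs: "set vs = verts G"
begin

abbreviation V where "V \<equiv> verts G"
abbreviation R where "R \<equiv> adjacent G"
abbreviation N where "N \<equiv> length vs"

lemma card_V: "card V = N"
  using distinct_card[OF distinct] set_vs by simp

lemma R_in: "R y z \<Longrightarrow> y \<in> V \<and> z \<in> V"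
  using adjacent_verts[OF simple] .

lemma finite_V: "finite V"
  using simple by (simp add: simple_graph_def)

lemma ex_nth: "(\<exists>x\<in>V. Q x) \<longleftrightarrow> (\<exists>i<N. Q (vs ! i))"
  unfolding set_vs[symmetric] by (metis in_set_conv_nth)

lemma nth_eq: "i < N \<Longrightarrow> j < N \<Longrightarrow> vs ! i = vs ! j \<longleftrightarrow> i = j"
  using distinct by (simp add: nth_eq_iff_index_eq)

definition adj_loaded :: "memory \<Rightarrow> bool" where
  "adj_loaded m \<longleftrightarrow> m (''n'', []) = N \<and> (\<forall>i<N. \<forall>j<N. m (''adj'', [i, j]) \<noteq> 0 \<longleftrightarrow> R (vs ! i) (vs ! j))"

definition loaded :: "memory \<Rightarrow> bool" where
  "loaded m \<longleftrightarrow> adj_loaded m \<and>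
     (\<forall>i<N. \<forall>j<N. m (''R'', [N, i, j, j]) \<noteq> 0 \<longleftrightarrow> reach_within V R N (vs ! i) (vs ! j) (vs ! j))"

lemma loaded_upd [simp]: "loaded (m((''v'', js) := x)) \<longleftrightarrow> loaded m"
  by (simp add: loaded_def adj_loaded_def)

lemma loaded_with_vars [simp]: "loaded (with_vars js m) \<longleftrightarrow> loaded m"
  by (simp add: loaded_def adj_loaded_def)

lemma loaded_n: "loaded m \<Longrightarrow> m (''n'', []) = N"
  by (simp add: loaded_def adj_loaded_def)

text \<open>Entries add up several hits, so only their being nonzero carries meaning.\<close>

lemma reach_table:
  assumes m: "adj_loaded m" and zero: "\<And>ix. m (''R'', 0 # ix) = 0"
    and rec: "\<And>t ix. t < N \<Longrightarrow> ix \<in> tuples 3 N \<Longrightarrow> m (''R'', Suc t # ix) = beval (with_vars (t # ix) m) reach_expr"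
  shows "t \<le> N \<Longrightarrow> i < N \<Longrightarrow> j < N \<Longrightarrow> l < N \<Longrightarrow>
    m (''R'', [t, i, j, l]) \<noteq> 0 \<longleftrightarrow> reach_within V R t (vs ! i) (vs ! j) (vs ! l)"
proof (induction t arbitrary: l)
  case 0
  then show ?case using zero by simp
next
  case (Suc t)
  have n: "m (''n'', []) = N" and adj: "\<And>i j. i < N \<Longrightarrow> j < N \<Longrightarrow> m (''adj'', [i, j]) \<noteq> 0 \<longleftrightarrow> R (vs ! i) (vs ! j)"
    using m by (simp_all add: adj_loaded_def)
  have "[i, j, l] \<in> tuples 3 N" using Suc.prems by (simp add: tuples_def)
  then have step: "m (''R'', [Suc t, i, j, l]) = beval (with_vars [t, i, j, l] m) reach_expr"
    using rec[of t "[i, j, l]"] Suc.prems(1) by simp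
  define S where "S = (\<Sum>z<N. if m (''R'', [t, i, j, z]) \<noteq> 0 then m (''adj'', [z, l]) else 0)"
  have "beval (with_vars [t, i, j, l] m) reach_expr = (if l \<noteq> j then m (''adj'', [i, l]) else 0) + (if l \<noteq> i then S else 0)"
    unfolding S_def by (simp add: reach_expr_def n nat_diff_add_diff_eq_0 del: add_is_0 cong: if_cong)
  then have eq: "m (''R'', [Suc t, i, j, l]) = (if l \<noteq> j then m (''adj'', [i, l]) else 0) + (if l \<noteq> i then S else 0)"
    using step by simp
  have IH: "m (''R'', [t, i, j, z]) \<noteq> 0 \<longleftrightarrow> reach_within V R t (vs ! i) (vs ! j) (vs ! z)" if "z < N" for z
    using Suc.IH[OF _ Suc.prems(2,3) that] Suc.prems(1) by simp
  have "S \<noteq> 0 \<longleftrightarrow> (\<exists>z<N. reach_within V R t (vs ! i) (vs ! j) (vs ! z) \<and> R (vs ! z) (vs ! l))"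
    unfolding S_def using IH adj[OF _ Suc.prems(4)] by (auto split: if_splits)
  moreover have "m (''adj'', [i, l]) \<noteq> 0 \<longleftrightarrow> R (vs ! i) (vs ! l)" using adj Suc.prems by blast
  ultimately show ?case
    unfolding eq reach_within.simps ex_nth nth_eq[OF Suc.prems(4,3)] nth_eq[OF Suc.prems(4,2)] by auto
qed

lemma cycle_edge_iff: "cycle_edge R x y \<longleftrightarrow> R x y \<and> reach_within V R N x y y"
  by (rule cycle_edge_iff_reach_within[where V = V, unfolded card_V]) (use R_in finite_V in blast)+

lemma cycle_expr_nonzero:
  assumes "loaded M" "eval_expr M a = i" "eval_expr M b = j" "i < N" "j < N"
  shows "beval M (cycle_expr a b) \<noteq> 0 \<longleftrightarrow> cycle_edge R (vs ! i) (vs ! j)"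
  unfolding cycle_edge_iff beval_cycle_expr
  using assms by (simp add: loaded_def adj_loaded_def)

lemma cut_expr_nonzero:
  assumes M: "loaded M" "eval_expr M a = s" "eval_expr M b = i" "eval_expr M c = j" "s < N" "i < N" "j < N"
  shows "beval M (cut_expr a b c) \<noteq> 0 \<longleftrightarrow> cut_cycle R (vs ! s) (vs ! i) (vs ! j)"
proof -
  have "M (''adj'', [i, j]) \<noteq> 0 \<longleftrightarrow> R (vs ! i) (vs ! j)"
    using M by (simp add: loaded_def adj_loaded_def)
  moreover note cycle_expr_nonzero[OF M(1,2,4,5,7)] cycle_expr_nonzero[OF M(1,2,3,5,6)]
  ultimately show ?thesis
    unfolding cut_expr_def cut_cycle_def nth_eq[OF M(6,5)] nth_eq[OF M(7,5)]
    using M(2,3,4) by (auto simp: nat_diff_add_diff_eq_0 simp del: add_is_0 split: if_splits)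
qed

lemma count_expr_value:
  assumes m: "loaded m" and X: "\<And>u. u < N \<Longrightarrow> m (''F'', [t, s, a, u, w]) = X (vs ! u)"
    and less: "s < N" "w < N" "p < N"
  shows "beval ((with_vars [t, s, a, w, p] m)((''v'', [5]) := j, (''v'', [6]) := i)) count_expr =
    card {u \<in> V. cut_cycle R (vs ! s) (vs ! w) u \<and> u \<noteq> vs ! p \<and> Suc i \<le> X u}" (is "beval ?M _ = _")
proof -
  have "beval ?M count_expr = (\<Sum>u<N. if cut_cycle R (vs ! s) (vs ! w) (vs ! u) \<and> vs ! u \<noteq> vs ! p \<and> Suc i \<le> X (vs ! u) then 1 else 0)"
  proof -
    have "beval (?M((''v'', [7]) := u)) (Cond (cut_expr (lv 1) (lv 3) (lv 7)) (Cond (neq (lv 7) (lv 4))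
       (Cond (Pure (Minus (Cell ''F'' [lv 0, lv 1, lv 2, lv 7, lv 3]) (lv 6))) one zero) zero) zero) =
       (if cut_cycle R (vs ! s) (vs ! w) (vs ! u) \<and> vs ! u \<noteq> vs ! p \<and> Suc i \<le> X (vs ! u) then 1 else 0)"
      (is "beval ?Mu (Cond ?c ?d _) = _") if u: "u < N" for u
    proof -
      have c: "beval ?Mu ?c \<noteq> 0 \<longleftrightarrow> cut_cycle R (vs ! s) (vs ! w) (vs ! u)"
        using m less u by (intro cut_expr_nonzero) simp_all
      have d: "beval ?Mu ?d = (if u \<noteq> p \<and> Suc i \<le> X (vs ! u) then 1 else 0)"
        using X[OF u] by (auto simp: nat_diff_add_diff_eq_0 simp del: add_is_0)
      have "beval ?Mu (Cond ?c ?d zero) = (if beval ?Mu ?c \<noteq> 0 then beval ?Mu ?d else 0)"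
        by (simp only: beval.simps eval_expr.simps)
      then show ?thesis unfolding c d nth_eq[OF u less(3)] by simp
    qed
    then have "(\<Sum>u<N. beval (?M((''v'', [7]) := u)) (Cond (cut_expr (lv 1) (lv 3) (lv 7)) (Cond (neq (lv 7) (lv 4))
       (Cond (Pure (Minus (Cell ''F'' [lv 0, lv 1, lv 2, lv 7, lv 3]) (lv 6))) one zero) zero) zero)) =
       (\<Sum>u<N. if cut_cycle R (vs ! s) (vs ! w) (vs ! u) \<and> vs ! u \<noteq> vs ! p \<and> Suc i \<le> X (vs ! u) then 1 else 0)"
      by (intro sum.cong refl) (simp only: lessThan_iff)
    moreover have "?M (''n'', []) = N" using loaded_n[OF m] by simp
    ultimately show ?thesis unfolding count_expr_def beval.simps(5)[of ?M] by (simp only:)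
  qed
  also have "\<dots> = card {u \<in> V. cut_cycle R (vs ! s) (vs ! w) u \<and> u \<noteq> vs ! p \<and> Suc i \<le> X u}"
    unfolding set_vs[symmetric] by (rule sum_nth_eq_card[OF distinct])
  finally show ?thesis .
qed

lemma msg_table:
  assumes m: "loaded m" and zero: "\<And>ix. m (''F'', 0 # ix) = 0"
    and rec: "\<And>t ix. t < N \<Longrightarrow> ix \<in> tuples 4 N \<Longrightarrow> m (''F'', Suc t # ix) = beval (with_vars (t # ix) m) msg_expr"
  shows "t \<le> N \<Longrightarrow> s < N \<Longrightarrow> a < N \<Longrightarrow> w < N \<Longrightarrow> p < N \<Longrightarrow>
    m (''F'', [t, s, a, w, p]) =
      msg V (cut_cycle R (vs ! s)) (cycle_edge R (vs ! s)) (Suc a) t (vs ! w) (vs ! p)"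
proof (induction t arbitrary: w p)
  case 0
  then show ?case using zero by simp
next
  case (Suc t)
  note less = Suc.prems(2-5)
  let ?X = "\<lambda>u. msg V (cut_cycle R (vs ! s)) (cycle_edge R (vs ! s)) (Suc a) t u (vs ! w)"
  let ?cnt = "\<lambda>i. card {u \<in> V. cut_cycle R (vs ! s) (vs ! w) u \<and> u \<noteq> vs ! p \<and> i \<le> ?X u}"
  let ?b = "cycle_edge R (vs ! s) (vs ! w)"
  let ?M = "with_vars [t, s, a, w, p] m"
  have "[s, a, w, p] \<in> tuples 4 N" using less by (simp add: tuples_def)
  then have eq: "m (''F'', [Suc t, s, a, w, p]) = beval ?M msg_expr"
    using rec[of t "[s, a, w, p]"] Suc.prems(1) by simp
  have X: "m (''F'', [t, s, a, u, w]) = ?X (vs ! u)" if "u < N" for u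
    using Suc.IH[of u w] Suc.prems that by simp
  have inner: "beval (?M((''v'', [5]) := j)) (Sum 6 (Sub (Pure (lv 5)) (Add (Add (Pure (lv 6)) count_expr) exempt_expr))) = 0
      \<longleftrightarrow> feasible ?cnt ?b (Suc a) (Suc j)" (is "?B = 0 \<longleftrightarrow> _") if j: "j < N" for j
  proof -
    have ex: "beval (?M((''v'', [5]) := j, (''v'', [6]) := i)) exempt_expr = (if ?b \<and> i \<le> a \<and> a < j then 1 else 0)" for i
    proof -
      have "beval (?M((''v'', [5]) := j, (''v'', [6]) := i)) (cycle_expr (lv 1) (lv 3)) \<noteq> 0 \<longleftrightarrow> ?b"
        using m less by (intro cycle_expr_nonzero) simp_all
      then show ?thesis by (auto simp: exempt_expr_def)
    qed
    have B: "?B = (\<Sum>i<N. j - (i + ?cnt (Suc i) + (if ?b \<and> i \<le> a \<and> a < j then 1 else 0)))" (is "_ = ?C")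
      using loaded_n[OF m] by (simp add: count_expr_value[OF m X less(1,3,4)] ex)
    \<comment> \<open>A sum of truncated differences vanishes exactly when all the inequalities
      hold.\<close>
    have C: "?C = 0 \<longleftrightarrow> (\<forall>i<N. j \<le> i + ?cnt (Suc i) + (if ?b \<and> i \<le> a \<and> a < j then 1 else 0))"
      by (simp only: sum_eq_0_iff finite_lessThan diff_is_0_eq Ball_def lessThan_iff)
    show ?thesis unfolding B C using feasible_Suc_iff[OF j, of ?cnt ?b a] by (rule sym)
  qed
  have n: "?M (''n'', []) = N" using loaded_n[OF m] by simp
  have "beval ?M msg_expr = (\<Sum>j<N. if feasible ?cnt ?b (Suc a) (Suc j) then 1 else 0)"
    unfolding msg_expr_def beval.simps(5)[of ?M] n
    by (intro sum.cong refl) (simp only: beval_Cond_zero_one inner lessThan_iff)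
  also have "\<dots> = msg V (cut_cycle R (vs ! s)) (cycle_edge R (vs ! s)) (Suc a) (Suc t) (vs ! w) (vs ! p)"
    by (simp only: sum_indicator_card msg.simps card_V)
  finally show ?case using eq by simp
qed

lemma out_expr_value:
  assumes m: "loaded m" and G: "unicyclic G"
    and F: "\<And>s a w. s < N \<Longrightarrow> a < N \<Longrightarrow> w < N \<Longrightarrow> m (''F'', [N, s, a, w, w]) =
      msg V (cut_cycle R (vs ! s)) (cycle_edge R (vs ! s)) (Suc a) N (vs ! w) (vs ! w)"
  shows "beval m out_expr = transitivity G"
proof -
  let ?msg = "\<lambda>s a w. msg V (cut_cycle R s) (cycle_edge R s) a N w w"
  have inner: "beval (m((''v'', [0]) := j)) (Sum 1 (Sum 2 (Sum 3 (Cond (Sum 4 (cycle_expr (lv 1) (lv 4)))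
     (Cond (Pure (Minus (Cell ''F'' [Cell ''n'' [], lv 1, lv 2, lv 1, lv 1]) (lv 2)))
        (Pure (Minus (Cell ''F'' [Cell ''n'' [], lv 1, lv 2, lv 3, lv 3]) (lv 0))) zero) zero)))) \<noteq> 0 \<longleftrightarrow>
     Suc j \<le> transitivity G" (is "?B \<noteq> 0 \<longleftrightarrow> _") for j
  proof -
    have body: "beval (m((''v'', [0]) := j, (''v'', [1]) := s, (''v'', [2]) := a, (''v'', [3]) := v))
        (Cond (Sum 4 (cycle_expr (lv 1) (lv 4)))
          (Cond (Pure (Minus (Cell ''F'' [Cell ''n'' [], lv 1, lv 2, lv 1, lv 1]) (lv 2)))
            (Pure (Minus (Cell ''F'' [Cell ''n'' [], lv 1, lv 2, lv 3, lv 3]) (lv 0))) zero) zero) \<noteq> 0 \<longleftrightarrow>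
        (\<exists>x\<in>V. cycle_edge R (vs ! s) x) \<and>
        Suc a \<le> ?msg (vs ! s) (Suc a) (vs ! s) \<and> Suc j \<le> ?msg (vs ! s) (Suc a) (vs ! v)"
      (is "beval ?M _ \<noteq> 0 \<longleftrightarrow> _") if less: "s < N" "a < N" "v < N" for s a v
    proof -
      have n: "?M (''n'', []) = N" using loaded_n[OF m] by simp
      have "beval (?M((''v'', [4]) := x)) (cycle_expr (lv 1) (lv 4)) \<noteq> 0 \<longleftrightarrow> cycle_edge R (vs ! s) (vs ! x)"
        if "x < N" for x
        using m less that by (intro cycle_expr_nonzero) simp_all
      then have A: "beval ?M (Sum 4 (cycle_expr (lv 1) (lv 4))) \<noteq> 0 \<longleftrightarrow> (\<exists>x\<in>V. cycle_edge R (vs ! s) x)"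
        unfolding beval_Sum_nonzero n ex_nth by blast
      have B: "beval ?M (Pure (Minus (Cell ''F'' [Cell ''n'' [], lv 1, lv 2, lv 1, lv 1]) (lv 2))) =
          ?msg (vs ! s) (Suc a) (vs ! s) - a"
        using loaded_n[OF m] F[OF less(1,2,1)] by simp
      have C: "beval ?M (Pure (Minus (Cell ''F'' [Cell ''n'' [], lv 1, lv 2, lv 3, lv 3]) (lv 0))) =
          ?msg (vs ! s) (Suc a) (vs ! v) - j"
        using loaded_n[OF m] F[OF less] by simp
      show ?thesis unfolding beval_Cond_nonzero A B C by (simp only: Suc_le_eq neq0_conv zero_less_diff)
    qed
    have n: "(m((''v'', js) := x)) (''n'', []) = N" "(m((''v'', js) := x, (''v'', js') := x')) (''n'', []) = N"
      "(m((''v'', js) := x, (''v'', js') := x', (''v'', js'') := x'')) (''n'', []) = N" for js x js' x' js'' x''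
      using loaded_n[OF m] by simp_all
    have "?B \<noteq> 0 \<longleftrightarrow> (\<exists>s<N. \<exists>a<N. \<exists>v<N. (\<exists>x\<in>V. cycle_edge R (vs ! s) x) \<and>
        Suc a \<le> ?msg (vs ! s) (Suc a) (vs ! s) \<and> Suc j \<le> ?msg (vs ! s) (Suc a) (vs ! v))"
      unfolding beval_Sum_nonzero n
      using body by (simp only: cong: conj_cong)
    also have "\<dots> \<longleftrightarrow> (\<exists>s\<in>V. \<exists>a. 1 \<le> a \<and> a \<le> card V \<and> (\<exists>v\<in>V. (\<exists>x\<in>V. cycle_edge R s x) \<and>
       a \<le> ?msg s a s \<and> Suc j \<le> ?msg s a v))"
    proof -
      have "(\<exists>a. 1 \<le> a \<and> a \<le> card V \<and> Q a) \<longleftrightarrow> (\<exists>a<N. Q (Suc a))" for Q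
        unfolding card_V by (metis One_nat_def Suc_le_D Suc_le_eq less_eq_Suc_le zero_less_Suc)
      then show ?thesis unfolding ex_nth by (simp only:)
    qed
    also have "\<dots> \<longleftrightarrow> Suc j \<le> transitivity G"
      using transitivity_ge_iff[OF G, of "Suc j"] unfolding card_V by simp
    finally show ?thesis .
  qed
  have "verts G \<noteq> {}" using G by (simp add: unicyclic_def connected_graph_def)
  then have le: "transitivity G \<le> N" using transitivity_bounds(1)[OF simple] card_V by simp
  have "beval m out_expr = (\<Sum>j<N. if Suc j \<le> transitivity G then 1 else 0)"
    unfolding out_expr_def beval.simps(5)[of m] loaded_n[OF m]
    by (intro sum.cong refl) (simp only: beval_Cond_one_zero inner)
  also have "\<dots> = card {j. j < N \<and> Suc j \<le> transitivity G}" by (rule sum_indicator_card)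
  also have "{j. j < N \<and> Suc j \<le> transitivity G} = {..<transitivity G}" using le by auto
  finally show ?thesis by simp
qed

lemma graph_input_loaded: "adj_loaded (graph_input G vs)"
  by (auto simp: adj_loaded_def graph_input_def)

lemma transitivity_prog_correct:
  assumes G: "unicyclic G"
  shows "\<exists>t s'. exec transitivity_prog (graph_input G vs) t s' \<and>
    t \<le> table_cost N 3 reach_expr + (table_cost N 4 msg_expr + (cost N out_expr + 1)) \<and>
    s' (''out'', []) = transitivity G"
proof -
  let ?m = "graph_input G vs"
  have n0: "?m (''n'', []) = N" using graph_input_loaded by (simp add: adj_loaded_def)
  \<comment> \<open>The cells start at zero, which is already the correct row 0 of both
    tables.\<close>
  have zero: "?m (''R'', ix) = 0" "?m (''F'', ix) = 0" for ix by (simp_all add: graph_input_def)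
  obtain u1 m1 where m1: "exec (table ''R'' 3 reach_expr) ?m u1 m1" "u1 \<le> table_cost N 3 reach_expr"
     "frame {''v'', ''t'', ''R''} ?m m1" "same_row ''R'' 0 ?m m1"
     "\<forall>i<N. \<forall>ix\<in>tuples 3 N. m1 (''R'', Suc i # ix) = beval (with_vars (i # ix) m1) reach_expr"
    using table_correct[where m = ?m and N = N, OF _ wf_reach_expr n0] by auto
  have adj1: "adj_loaded m1"
    using graph_input_loaded frameD[OF m1(3), of "''n''"] frameD[OF m1(3), of "''adj''"] by (simp add: adj_loaded_def)
  have zero1: "m1 (''R'', 0 # ix) = 0" "m1 (''F'', ix) = 0" for ix
    using m1(4) zero frameD[OF m1(3), of "''F''"] by (simp_all add: same_row_def)
  have load1: "loaded m1"
    unfolding loaded_def using adj1 reach_table[OF adj1 zero1(1)] m1(5) by simp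
  obtain u2 m2 where m2: "exec (table ''F'' 4 msg_expr) m1 u2 m2" "u2 \<le> table_cost N 4 msg_expr"
     "frame {''v'', ''t'', ''F''} m1 m2" "same_row ''F'' 0 m1 m2"
     "\<forall>i<N. \<forall>ix\<in>tuples 4 N. m2 (''F'', Suc i # ix) = beval (with_vars (i # ix) m2) msg_expr"
    using table_correct[where m = m1 and N = N, OF _ wf_msg_expr loaded_n[OF load1]] by auto
  have load2: "loaded m2"
    using load1 frameD[OF m2(3), of "''n''"] frameD[OF m2(3), of "''adj''"] frameD[OF m2(3), of "''R''"]
    by (simp add: loaded_def adj_loaded_def)
  have zero2: "m2 (''F'', 0 # ix) = 0" for ix using m2(4) zero1 by (simp add: same_row_def)
  have F: "m2 (''F'', [N, s, a, w, w]) = msg V (cut_cycle R (vs ! s)) (cycle_edge R (vs ! s)) (Suc a) N (vs ! w) (vs ! w)"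
    if "s < N" "a < N" "w < N" for s a w
    using msg_table[OF load2 zero2 m2(5)[rule_format] le_refl that that(3)] by simp
  obtain u3 m3 where m3: "exec (compile 0 out_expr) m2 u3 m3" "u3 \<le> cost N out_expr" "m3 (''t'', [0]) = beval m2 out_expr"
    using compile_correct[where m = m2 and N = N and d = 0, OF wf_out_expr _ loaded_n[OF load2]] by auto
  let ?m4 = "m3((''out'', []) := m3 (''t'', [0]))"
  have "exec (Assign ''out'' [] (tv 0)) m3 1 ?m4" by (rule exec_AssignI) simp_all
  then have "exec transitivity_prog ?m (u1 + (u2 + (u3 + 1))) ?m4"
    unfolding transitivity_prog_def by (intro exec.Seq[OF m1(1)] exec.Seq[OF m2(1)] exec.Seq[OF m3(1)])
  moreover have "?m4 (''out'', []) = transitivity G"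
    using m3(3) out_expr_value[OF load2 G F] by simp
  moreover have "u1 + (u2 + (u3 + 1)) \<le> table_cost N 3 reach_expr + (table_cost N 4 msg_expr + (cost N out_expr + 1))"
    using m1(2) m2(2) m3(2) by linarith
  ultimately show ?thesis by blast
qed

end

lemma transitivity_poly_time: "poly_time_computable_on (unicyclic :: 'a graph \<Rightarrow> bool) transitivity"
proof -
  have "poly_bounded (\<lambda>n. table_cost n 3 reach_expr + (table_cost n 4 msg_expr + (cost n out_expr + 1)))"
    by (intro poly_bounded_intros poly_bounded_table_cost poly_bounded_cost)
  then obtain q where q: "\<And>n. table_cost n 3 reach_expr + (table_cost n 4 msg_expr + (cost n out_expr + 1)) \<le> poly q n"
    unfolding poly_bounded_def by blast
  show ?thesis
    unfolding poly_time_computable_on_def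
  proof (intro exI[of _ transitivity_prog] exI[of _ q] allI impI)
    fix G :: "'a graph" and vs
    assume *: "unicyclic G \<and> distinct vs \<and> set vs = verts G"
    then interpret enumerated_graph G vs by unfold_locales (auto simp: unicyclic_def)
    show "\<exists>t s'. exec transitivity_prog (graph_input G vs) t s' \<and> t \<le> poly q (length vs) \<and> s' (''out'', []) = transitivity G"
      using transitivity_prog_correct * q le_trans by blast
  qed
qed

theorem theorem2:
  shows "poly_time_computable_on (unicyclic :: 'a graph \<Rightarrow> bool) transitivity \<and>
         (\<forall>G :: 'a graph. unicyclic G \<longrightarrow> upper_domatic_number G = transitivity G) \<and>
         poly_time_computable_on (unicyclic :: 'a graph \<Rightarrow> bool) upper_domatic_number"
proof -
  \<comment> \<open>The two numbers agree on all admissible inputs, so the same program and the same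
    bound serve for both.\<close>
  have "poly_time_computable_on (unicyclic :: 'a graph \<Rightarrow> bool) upper_domatic_number"
    using transitivity_poly_time[where 'a = 'a] unfolding poly_time_computable_on_def
    by (simp add: upper_domatic_number_eq cong: conj_cong imp_cong)
  then show ?thesis using transitivity_poly_time upper_domatic_number_eq by blast
qed

end
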